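(* Let $\mathbf P$ be the t-SNE similarity matrix and, for $\ell\in\{1,2\}$, let $\mathbf Y_\ell(t)=\exp(-t\mathbf L(\alpha\mathbf P-\mathbf H_n))\mathbf y_\ell^{(0)}$ be the solution of $\dot{\mathbf Y}_\ell(t)=-\mathbf L(\alpha\mathbf P-\mathbf H_n)\mathbf Y_\ell(t)$, $\mathbf Y_\ell(0)=\mathbf y_\ell^{(0)}\in\mathbb R^n$, where $\mathbf H_n=\frac1{n(n-1)}(\mathbf 1_n\mathbf 1_n^\top-\mathbf I_n)$. Suppose that as $n\to\infty$ (with $\alpha>0$, $t>0$ possibly depending on $n$): (i) $\min_{\ell}\|\mathbf y_\ell^{(0)}\|_2>0$ and $\max_{\ell}\|\mathbf y_\ell^{(0)}\|_\infty=O(1)$; (ii) there exists a symmetric well-conditioned matrix $\mathbf P^*\in\mathbb R^{n\times n}$, whose associated weighted graph has $R\ge2$ connected components, such that $\lambda_{R+1}(\mathbf L(\mathbf P^* ))\gg\max\{(t\alpha)^{-1},\|\mathbf L(\mathbf P^*-\mathbf P)\|\}$ and $t\alpha\|\mathbf L(\mathbf P^*-\mathbf P)\|=o(1)$; (iii) $\alpha\gg[n\lambda_{R+1}(\mathbf L(\mathbf P))]^{-1}$ and $t=o(n)$. Let $\mathbf U_0\in\mathbb R^{n\times R}$ have orthonormal columns spanning the null space of $\mathbf L(\mathbf P^* )$. Then $$\lim_{n\to\infty}\frac{\|\mathbf Y_\ell(t)-\mathbf U_0\mathbf U_0^\top\mathbf Y_\ell(t)\|_2}{\|\mathbf Y_\ell(0)\|_2}=0,\qquad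 \ell\in\{1,2\},$$ and there exists a permutation matrix $O\in\mathbb R^{n\times n}$ such that $$\lim_{n\to\infty}\frac{\|\mathbf Y_\ell(t)-O\mathbf z_\ell\|_2}{\|\mathbf Y_\ell(0)\|_2}=0,\qquad \ell\in\{1,2\},$$ where $\mathbf z_\ell=(z_{\ell1},\dots,z_{\ell1},\dots,z_{\ell R},\dots,z_{\ell R})^\top\in\mathbb R^n$ with $z_{\ell r}$ repeated $n_r$ times, $n_r$ is the size of the $r$-th connected component of the graph of $\mathbf P^*$, $z_{\ell r}=\boldsymbol\theta_r^\top\mathbf y_\ell^{(0)}/\sqrt{n_r}$, and $\boldsymbol\theta_r$ has entries $1/\sqrt{n_r}$ on the nodes of the $r$-th component and $0$ elsewhere.
   Context: For each $n\ge2$ there are data points $X_1,\dots,X_n\in\mathbb R^p$ ($p$ and the data may depend on $n$) and bandwidths $\tau_i>0$. The matrix $\mathbf P=(p_{ij})\in\mathbb R^{n\times n}$ is given by $p_{ii}=0$ and, for $i\ne j$, $p_{ij}=\frac{p_{i|j}+p_{j|i}}{2n}$ with $p_{j|i}=\frac{\exp(-\|X_i-X_j\|_2^2/2\tau_i^2)}{\sum_{\ell\ne i}\exp(-\|X_i-X_\ell\|_2^2/2\tau_i^2)}$. A symmetric nonnegative matrix (weighted adjacency matrix) is well-conditioned if its associated weighted graph (nodes $1,\dots,n$, distinct $i,j$ adjacent iff the $(i,j)$ entry is nonzero) has $R\ge2$ connected components. For symmetric $\mathbf A$, $\mathbf L(\mathbf A)=\mathbf D(\mathbf A)-\mathbf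 A$ with $\mathbf D(\mathbf A)=\mathrm{diag}(\sum_i a_{i1},\dots,\sum_i a_{in})$; eigenvalues are ordered increasingly $\lambda_1\le\dots\le\lambda_n$. $\|\cdot\|$ is the spectral norm, $\|\cdot\|_\infty$ on vectors the sup norm. $a_n\ll b_n$ (equivalently $b_n\gg a_n$, $a_n=o(b_n)$) means $a_n/b_n\to0$; $a_n=O(b_n)$ means $a_n\le Cb_n$ for all $n$ for some constant $C$. *)

theory Defs
  imports
    "HOL-Library.Landau_Symbols"
    "HOL-Combinatorics.Permutations"
    "Jordan_Normal_Form.Char_Poly"
    "Jordan_Normal_Form.Matrix_Kernel"
begin

text \<open>
  Since the dimension is the asymptotic parameter, vectors and matrices have their dimension
  carried by terms. All indices are 0-based: the nodes are \<open>0, \<dots>, n - 1\<close> and the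
  components of a graph are numbered \<open>0, \<dots>, R - 1\<close>.
\<close>

definition norm2 :: "real vec \<Rightarrow> real" where
  "norm2 v = sqrt (v \<bullet> v)"

definition norm_sup :: "real vec \<Rightarrow> real" where
  "norm_sup v = Max ((\<lambda>i. \<bar>v $ i\<bar>) ` {..<dim_vec v})"

definition spectral_norm :: "real mat \<Rightarrow> real" where
  "spectral_norm A = (SUP v \<in> {v \<in> carrier_vec (dim_col A). norm2 v \<le> 1}. norm2 (A *\<^sub>v v))"

text \<open>
  The \<open>k\<close>-th smallest eigenvalue, \<open>1 \<le> k \<le> n\<close>, counted with multiplicity. It is
  meant for symmetric matrices, whose characteristic polynomial has \<open>n\<close> real roots.
\<close>

definition eigval :: "real mat \<Rightarrow> nat \<Rightarrow> real" where
  "eigval A k = sorted_list_of_multiset (proots (char_poly A)) ! (k - 1)"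

definition mat_exp :: "real mat \<Rightarrow> real mat" where
  "mat_exp A = mat (dim_row A) (dim_row A) (\<lambda>(i, j). \<Sum>k. (A ^\<^sub>m k) $$ (i, j) / fact k)"

definition permutation_matrix :: "nat \<Rightarrow> real mat \<Rightarrow> bool" where
  "permutation_matrix n Q \<longleftrightarrow>
     (\<exists>\<pi>. \<pi> permutes {..<n} \<and> Q = mat n n (\<lambda>(i, j). if i = \<pi> j then 1 else 0))"

definition degree_matrix :: "real mat \<Rightarrow> real mat" where
  "degree_matrix A = mat_diag (dim_col A) (\<lambda>j. \<Sum>i<dim_row A. A $$ (i, j))"

definition laplacian :: "real mat \<Rightarrow> real mat" where
  "laplacian A = degree_matrix A - A"

definition adjacent :: "real mat \<Rightarrow> (nat \<times> nat) set" where
  "adjacent A = {(i, j). i < dim_row A \<and> j < dim_row A \<and> i \<noteq> j \<and> A $$ (i, j) \<noteq> 0}"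

text \<open>The connected components, as vertex sets: the classes of mutually reachable nodes.\<close>

definition components :: "real mat \<Rightarrow> nat set set" where
  "components A =
     {..<dim_row A} // ((adjacent A)\<^sup>* \<inter> {..<dim_row A} \<times> {..<dim_row A})"

definition weighted_adjacency :: "nat \<Rightarrow> real mat \<Rightarrow> bool" where
  "weighted_adjacency n A \<longleftrightarrow>
     A \<in> carrier_mat n n \<and> A\<^sup>T = A \<and> (\<forall>i<n. \<forall>j<n. 0 \<le> A $$ (i, j))"

definition well_conditioned :: "nat \<Rightarrow> real mat \<Rightarrow> bool" where
  "well_conditioned n A \<longleftrightarrow> weighted_adjacency n A \<and> 2 \<le> card (components A)"

text \<open>\<open>tsne_cond n X \<tau> i j\<close> is the conditional similarity \<open>p\<^bsub>j|i\<^esub>\<close>.\<close>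

definition tsne_cond :: "nat \<Rightarrow> (nat \<Rightarrow> real vec) \<Rightarrow> (nat \<Rightarrow> real) \<Rightarrow> nat \<Rightarrow> nat \<Rightarrow> real" where
  "tsne_cond n X \<tau> i j =
     exp (- (norm2 (X i - X j))\<^sup>2 / (2 * (\<tau> i)\<^sup>2)) /
     (\<Sum>l \<in> {..<n} - {i}. exp (- (norm2 (X i - X l))\<^sup>2 / (2 * (\<tau> i)\<^sup>2)))"

definition tsne_P :: "nat \<Rightarrow> (nat \<Rightarrow> real vec) \<Rightarrow> (nat \<Rightarrow> real) \<Rightarrow> real mat" where
  "tsne_P n X \<tau> = mat n n (\<lambda>(i, j).
     if i = j then 0 else (tsne_cond n X \<tau> j i + tsne_cond n X \<tau> i j) / (2 * real n))"

definition H_mat :: "nat \<Rightarrow> real mat" where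
  "H_mat n = (1 / (real n * (real n - 1))) \<cdot>\<^sub>m (mat n n (\<lambda>_. 1) - 1\<^sub>m n)"

definition component_vec :: "nat \<Rightarrow> nat set \<Rightarrow> real vec" where
  "component_vec n S = vec n (\<lambda>i. if i \<in> S then 1 / sqrt (real (card S)) else 0)"

text \<open>
  For components \<open>C 0, \<dots>, C (R - 1)\<close> with \<open>n\<^sub>r = card (C r)\<close>, this is the vector whose
  \<open>r\<close>-th block consists of \<open>n\<^sub>r\<close> copies of \<open>\<theta>\<^sub>r \<bullet> y / sqrt n\<^sub>r\<close>.
\<close>

definition block_vec :: "nat \<Rightarrow> nat \<Rightarrow> (nat \<Rightarrow> nat set) \<Rightarrow> real vec \<Rightarrow> real vec" where
  "block_vec n R C y = vec_of_list (concat (map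
     (\<lambda>r. replicate (card (C r)) ((component_vec n (C r) \<bullet> y) / sqrt (real (card (C r)))))
     [0..<R]))"

text \<open>
  The series defining \<open>mat_exp\<close> converges entrywise, and \<open>s \<mapsto> mat_exp (- s A) y\<close> solves
  the initial value problem \<open>Y' = - A Y\<close>, \<open>Y 0 = y\<close>.
\<close>

lemma pow_mat_entry_bound:
  fixes A :: "real mat"
  assumes A: "A \<in> carrier_mat n n"
  obtains c where "c \<ge> 0" and
    "\<And>k i j. i < n \<Longrightarrow> j < n \<Longrightarrow> \<bar>(A ^\<^sub>m k) $$ (i, j)\<bar> \<le> c ^ k"
proof -
  define c where "c = (\<Sum>l<n. \<Sum>j<n. \<bar>A $$ (l, j)\<bar>)"
  have c0: "c \<ge> 0" unfolding c_def by (intro sum_nonneg) auto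
  have "\<bar>(A ^\<^sub>m k) $$ (i, j)\<bar> \<le> c ^ k" if "i < n" "j < n" for k i j
    using that
  proof (induction k arbitrary: j)
    case 0
    then show ?case using A by auto
  next
    case (Suc k)
    have Ak: "A ^\<^sub>m k \<in> carrier_mat n n" using A by simp
    have "(A ^\<^sub>m Suc k) $$ (i, j) = (\<Sum>l<n. (A ^\<^sub>m k) $$ (i, l) * A $$ (l, j))"
      using A Ak Suc.prems by (simp add: scalar_prod_def lessThan_atLeast0)
    also have "\<bar>\<dots>\<bar> \<le> (\<Sum>l<n. \<bar>(A ^\<^sub>m k) $$ (i, l)\<bar> * \<bar>A $$ (l, j)\<bar>)"
      by (rule order_trans[OF sum_abs]) (simp add: abs_mult)
    also have "\<dots> \<le> (\<Sum>l<n. c ^ k * \<bar>A $$ (l, j)\<bar>)"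
      using Suc by (intro sum_mono mult_right_mono) auto
    also have "\<dots> \<le> (\<Sum>l<n. c ^ k * (\<Sum>j<n. \<bar>A $$ (l, j)\<bar>))"
      using Suc.prems c0
      by (intro sum_mono mult_left_mono member_le_sum[where f = "\<lambda>j. \<bar>A $$ (_, j)\<bar>"]) auto
    also have "\<dots> = c ^ Suc k"
      unfolding sum_distrib_left[symmetric] c_def[symmetric] by (simp add: mult.commute)
    finally show ?case .
  qed
  with c0 show ?thesis using that by blast
qed

lemma pow_mat_smult:
  fixes A :: "real mat"
  assumes A: "A \<in> carrier_mat n n"
  shows "(c \<cdot>\<^sub>m A) ^\<^sub>m k = c ^ k \<cdot>\<^sub>m (A ^\<^sub>m k)"
proof (induction k)
  case 0
  then show ?case using A by (auto intro!: eq_matI)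
next
  case (Suc k)
  have Ak: "A ^\<^sub>m k \<in> carrier_mat n n" using A by simp
  show ?case using A Ak Suc
    by (simp add: mult_smult_distrib[OF Ak A] mult_smult_assoc_mat[OF Ak A])
      (auto intro!: eq_matI simp: mult_ac)
qed

lemma mat_exp_summable:
  fixes A :: "real mat"
  assumes A: "A \<in> carrier_mat n n" and ij: "i < n" "j < n"
  shows "summable (\<lambda>k. (A ^\<^sub>m k) $$ (i, j) / fact k * x ^ k)"
proof -
  obtain c where c: "c \<ge> 0" "\<bar>(A ^\<^sub>m k) $$ (i, j)\<bar> \<le> c ^ k" for k
    using pow_mat_entry_bound[OF A] ij by metis
  have "summable (\<lambda>k. (c * \<bar>x\<bar>) ^ k / fact k)"
    using summable_exp[of "c * \<bar>x\<bar>"] by (simp add: field_simps)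
  then show ?thesis
  proof (rule summable_comparison_test'[where N = 0])
    fix k
    show "norm ((A ^\<^sub>m k) $$ (i, j) / fact k * x ^ k) \<le> (c * \<bar>x\<bar>) ^ k / fact k"
      using mult_right_mono[OF c(2)[of k], of "\<bar>x\<bar> ^ k"]
      by (simp add: abs_mult power_abs power_mult_distrib divide_right_mono)
  qed
qed

lemma mat_exp_zero:
  assumes A: "A \<in> carrier_mat n n"
  shows "mat_exp (0 \<cdot>\<^sub>m A) = 1\<^sub>m n"
proof -
  have "(\<Sum>k. 0 ^ k * (A ^\<^sub>m k) $$ (i, j) / fact k) = (A ^\<^sub>m 0) $$ (i, j)" for i j
    using powser_zero[of "\<lambda>k. (A ^\<^sub>m k) $$ (i, j) / fact k"] by (simp add: mult.commute)
  then show ?thesis using A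
    by (intro eq_matI) (simp_all add: mat_exp_def pow_mat_smult[OF A])
qed

lemma mat_exp_deriv:
  assumes A: "A \<in> carrier_mat n n" and ij: "i < n" "j < n"
  shows "((\<lambda>s. mat_exp (s \<cdot>\<^sub>m A) $$ (i, j)) has_real_derivative
          (A * mat_exp (s \<cdot>\<^sub>m A)) $$ (i, j)) (at s)"
proof -
  define a where "a l k = (A ^\<^sub>m k) $$ (l, j) / fact k" for l k
  have E: "mat_exp (s \<cdot>\<^sub>m A) $$ (l, j) = (\<Sum>k. a l k * s ^ k)" if "l < n" for l s
    using that ij A by (simp add: mat_exp_def pow_mat_smult[OF A] a_def mult.commute)
  have sm: "summable (\<lambda>k. a l k * x ^ k)" if "l < n" for l x
    using mat_exp_summable[OF A that ij(2)] by (simp add: a_def)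
  have Suc_pow: "A ^\<^sub>m Suc k = A * A ^\<^sub>m k" for k
  proof (induction k)
    case (Suc k)
    have "A ^\<^sub>m k \<in> carrier_mat n n" using A by simp
    then show ?case using A Suc by (simp add: assoc_mult_mat[of A n n _ n A n])
  qed (use A in simp)
  have d: "diffs (a i) k = (\<Sum>l<n. A $$ (i, l) * a l k)" for k
  proof -
    have "A ^\<^sub>m k \<in> carrier_mat n n" using A by simp
    then have "(A ^\<^sub>m Suc k) $$ (i, j) = (\<Sum>l<n. A $$ (i, l) * (A ^\<^sub>m k) $$ (l, j))"
      unfolding Suc_pow using A ij by (simp add: scalar_prod_def lessThan_atLeast0)
    moreover have "diffs (a i) k = (A ^\<^sub>m Suc k) $$ (i, j) / fact k"
      by (simp add: diffs_def a_def del: pow_mat.simps of_nat_Suc)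
    ultimately show ?thesis by (simp add: a_def sum_divide_distrib)
  qed
  have "((\<lambda>s. \<Sum>k. a i k * s ^ k) has_real_derivative (\<Sum>k. diffs (a i) k * s ^ k)) (at s)"
    by (rule termdiffs_strong_converges_everywhere) (rule sm[OF ij(1)])
  also have "(\<Sum>k. diffs (a i) k * s ^ k) = (\<Sum>k. \<Sum>l<n. A $$ (i, l) * (a l k * s ^ k))"
    by (simp add: d sum_distrib_right mult.assoc)
  also have "\<dots> = (\<Sum>l<n. \<Sum>k. A $$ (i, l) * (a l k * s ^ k))"
    by (intro suminf_sum summable_mult sm) auto
  also have "\<dots> = (\<Sum>l<n. A $$ (i, l) * mat_exp (s \<cdot>\<^sub>m A) $$ (l, j))"
    by (intro sum.cong refl) (simp add: E suminf_mult sm)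
  also have "\<dots> = (A * mat_exp (s \<cdot>\<^sub>m A)) $$ (i, j)"
    using A ij by (simp add: mat_exp_def scalar_prod_def lessThan_atLeast0)
  finally show ?thesis using E[OF ij(1)] by simp
qed

lemma mat_exp_solves_ivp:
  fixes A :: "real mat"
  assumes A: "A \<in> carrier_mat n n" and y: "y \<in> carrier_vec n"
  defines "Y \<equiv> \<lambda>s. mat_exp (- s \<cdot>\<^sub>m A) *\<^sub>v y"
  shows "Y 0 = y"
    and "\<And>s i. i < n \<Longrightarrow> ((\<lambda>s. Y s $ i) has_real_derivative - (A *\<^sub>v Y s) $ i) (at s)"
proof -
  show "Y 0 = y" using mat_exp_zero[OF A] y by (simp add: Y_def)
next
  fix s i assume i: "i < n"
  have E: "mat_exp (s \<cdot>\<^sub>m A) \<in> carrier_mat n n" for s using A by (simp add: mat_exp_def)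
  have Ysi: "Y s $ i = (\<Sum>j<n. mat_exp (- s \<cdot>\<^sub>m A) $$ (i, j) * y $ j)" for s
    using i y carrier_matD[OF E[of "- s"]]
    by (simp add: Y_def scalar_prod_def lessThan_atLeast0)
  have "((\<lambda>s. \<Sum>j<n. mat_exp (- s \<cdot>\<^sub>m A) $$ (i, j) * y $ j) has_real_derivative
      (\<Sum>j<n. (A * mat_exp (- s \<cdot>\<^sub>m A)) $$ (i, j) * (- 1) * y $ j)) (at s)"
    by (intro DERIV_sum DERIV_cmult_right DERIV_chain2[OF mat_exp_deriv[OF A i]])
      (auto intro!: derivative_eq_intros)
  also have "(\<Sum>j<n. (A * mat_exp (- s \<cdot>\<^sub>m A)) $$ (i, j) * (- 1) * y $ j) =
      - ((A * mat_exp (- s \<cdot>\<^sub>m A)) *\<^sub>v y) $ i"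
  proof -
    define B where "B = A * mat_exp (- s \<cdot>\<^sub>m A)"
    have "B \<in> carrier_mat n n" unfolding B_def using A E[of "- s"] by (rule mult_carrier_mat)
    then show ?thesis unfolding B_def[symmetric] using i y
      by (simp add: scalar_prod_def lessThan_atLeast0 sum_negf)
  qed
  also have "\<dots> = - (A *\<^sub>v Y s) $ i"
    unfolding Y_def using assoc_mult_mat_vec[OF A E[of "- s"] y] by simp
  finally show "((\<lambda>s. Y s $ i) has_real_derivative - (A *\<^sub>v Y s) $ i) (at s)"
    unfolding Ysi .
qed

end

theory Submission
  imports Defs "HOL-Analysis.Function_Topology" "HOL-Analysis.L2_Norm"
begin

hide_const (open) Connected.components

text \<open>
  Write the generator as \<open>L(\<alpha> P - H) = \<alpha> L(P*) + D\<close>. Over the time span \<open>t\<close> the perturbation is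
  negligible, since \<open>t \<parallel>D\<parallel> \<le> t \<alpha> \<parallel>L(P* - P)\<parallel> + t / (n - 1)\<close> tends to \<open>0\<close>. Energy estimates for the
  flow then suffice: the part of \<open>Y(t)\<close> orthogonal to the kernel of \<open>L(P*)\<close> decays at rate
  \<open>exp (- t \<alpha> \<lambda>\<^bsub>R+1\<^esub>)\<close> up to an error of order \<open>sqrt (t \<parallel>D\<parallel>)\<close>, and the part in the kernel moves by
  \<open>O(t \<parallel>D\<parallel>)\<close>. So \<open>Y(t)\<close> is close to the projection of \<open>Y(0)\<close> onto the span of the normalised
  indicators of the components, which is the block vector up to a relabelling of the nodes.
\<close>

subsection \<open>Euclidean and spectral norm\<close>

text \<open>The matrix \<alpha> P - H may have negative entries, so its Laplacian need not be
  positive semidefinite and the flow need not contract. It still cannot grow faster than exp (s d),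
  where d bounds the perturbation, and this factor runs through all estimates. The square root in
  the error comes from estimating a squared norm: the perturbation enters the derivative of the
  squared orthogonal part as a source of order d times the squared norm of the flow. The second
  obstacle is that \<open>eigval\<close> is an entry of the sorted list of roots of a characteristic
  polynomial, whereas energy estimates want a lower bound for a quadratic form. The bridge is to
  extend the component indicators, which are kernel vectors, to an orthonormal eigenbasis and to
  count eigenvalues. Since the span lies in the kernel, best approximation transfers the
  bound.\<close>

lemma norm2_L2_set: "norm2 v = L2_set (($) v) {..<dim_vec v}"
  by (simp add: norm2_def L2_set_def scalar_prod_def power2_eq_square lessThan_atLeast0)

lemma norm2_nonneg [simp]: "0 \<le> norm2 v"
  by (simp add: norm2_L2_set)

lemma norm2_power2: "(norm2 v)\<^sup>2 = v \<bullet> v"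
  by (simp add: norm2_def scalar_prod_def sum_nonneg)

lemma scalar_prod_self_nonneg [simp]: "0 \<le> v \<bullet> (v :: real vec)"
  by (simp flip: norm2_power2)

lemma norm2_add_le:
  assumes "u \<in> carrier_vec n" "v \<in> carrier_vec n"
  shows "norm2 (u + v) \<le> norm2 u + norm2 v"
proof -
  have "norm2 (u + v) = L2_set (\<lambda>i. u $ i + v $ i) {..<n}"
    unfolding norm2_L2_set using assms by (intro L2_set_cong) auto
  also have "\<dots> \<le> L2_set (($) u) {..<n} + L2_set (($) v) {..<n}"
    by (rule L2_set_triangle_ineq)
  finally show ?thesis using assms by (simp add: norm2_L2_set)
qed

lemma norm2_smult: "norm2 (c \<cdot>\<^sub>v v) = \<bar>c\<bar> * norm2 v"
proof -
  have "(c \<cdot>\<^sub>v v) \<bullet> (c \<cdot>\<^sub>v v) = c\<^sup>2 * (v \<bullet> v)"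
    by (simp add: power2_eq_square)
  then show ?thesis by (simp add: norm2_def real_sqrt_mult)
qed

lemma norm2_diff_le:
  assumes "u \<in> carrier_vec n" "v \<in> carrier_vec n"
  shows "norm2 (u - v) \<le> norm2 u + norm2 v"
proof -
  have "u - v = u + (- 1) \<cdot>\<^sub>v v" using assms by (intro eq_vecI) auto
  then show ?thesis using norm2_add_le[of u n "(- 1) \<cdot>\<^sub>v v"] assms by (simp add: norm2_smult)
qed

lemma abs_scalar_prod_le:
  assumes "u \<in> carrier_vec n" "v \<in> carrier_vec n"
  shows "\<bar>u \<bullet> v\<bar> \<le> norm2 u * norm2 v"
proof -
  have "\<bar>u \<bullet> v\<bar> \<le> (\<Sum>i<n. \<bar>u $ i\<bar> * \<bar>v $ i\<bar>)"
    using assms sum_abs[of "\<lambda>i. u $ i * v $ i" "{..<n}"]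
    by (simp add: scalar_prod_def abs_mult lessThan_atLeast0)
  also have "\<dots> \<le> norm2 u * norm2 v"
    using L2_set_mult_ineq[of "($) u" "($) v"] assms by (simp add: norm2_L2_set)
  finally show ?thesis .
qed

lemma norm2_zero_iff:
  assumes "v \<in> carrier_vec n"
  shows "norm2 v = 0 \<longleftrightarrow> v = 0\<^sub>v n"
  using assms by (auto simp: norm2_L2_set L2_set_eq_0_iff intro!: eq_vecI)

text \<open>A real supremum bounds its members only once the set is known to be bounded above. A
  crude bound suffices for this, here the sum of the row norms; homogeneity then extends the
  estimate from the unit ball to all vectors.\<close>

lemma norm2_mult_mat_vec_le:
  assumes A: "A \<in> carrier_mat m n" and v: "v \<in> carrier_vec n"
  shows "norm2 (A *\<^sub>v v) \<le> spectral_norm A * norm2 v"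
proof -
  define S where "S = {v \<in> carrier_vec n. norm2 v \<le> 1}"
  have bound: "norm2 (A *\<^sub>v w) \<le> (\<Sum>i<m. norm2 (row A i))" if "w \<in> S" for w
  proof -
    have "norm2 (A *\<^sub>v w) \<le> (\<Sum>i<m. \<bar>(A *\<^sub>v w) $ i\<bar>)"
      using A by (auto simp: norm2_L2_set intro!: order_trans[OF L2_set_le_sum_abs])
    also have "\<dots> \<le> (\<Sum>i<m. norm2 (row A i))"
    proof (rule sum_mono)
      fix i assume "i \<in> {..<m}"
      then have "\<bar>(A *\<^sub>v w) $ i\<bar> \<le> norm2 (row A i) * norm2 w"
        using A that abs_scalar_prod_le[of "row A i" n w] by (auto simp: S_def)
      also have "\<dots> \<le> norm2 (row A i) * 1"
        using that by (intro mult_left_mono) (auto simp: S_def)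
      finally show "\<bar>(A *\<^sub>v w) $ i\<bar> \<le> norm2 (row A i)" by simp
    qed
    finally show ?thesis .
  qed
  have bdd: "bdd_above ((\<lambda>w. norm2 (A *\<^sub>v w)) ` S)"
    using bound by (intro bdd_aboveI2)
  have sup: "norm2 (A *\<^sub>v w) \<le> spectral_norm A" if "w \<in> S" for w
    unfolding spectral_norm_def using cSUP_upper[OF that bdd] A by (simp add: S_def)
  show ?thesis
  proof (cases "norm2 v = 0")
    case True
    then have "v = 0\<^sub>v n" using v by (simp add: norm2_zero_iff)
    then have "A *\<^sub>v v = 0\<^sub>v m" using A by auto
    then show ?thesis using True norm2_zero_iff[of "0\<^sub>v m" m] by simp
  next
    case False
    then have pos: "norm2 v > 0" using norm2_nonneg[of v] by linarith
    define w where "w = (1 / norm2 v) \<cdot>\<^sub>v v"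
    have "w \<in> S" using pos v by (simp add: S_def w_def norm2_smult)
    moreover have "A *\<^sub>v w = (1 / norm2 v) \<cdot>\<^sub>v (A *\<^sub>v v)"
      unfolding w_def using A v by (simp add: mult_mat_vec)
    ultimately have "norm2 (A *\<^sub>v v) / norm2 v \<le> spectral_norm A"
      using sup[of w] by (simp add: norm2_smult)
    then show ?thesis using pos by (simp add: field_simps)
  qed
qed

subsection \<open>Orthonormal eigenbases of symmetric matrices\<close>

lemma scalar_prod_symmetric_mat:
  fixes A :: "real mat"
  assumes "A \<in> carrier_mat n n" "A\<^sup>T = A" "u \<in> carrier_vec n" "v \<in> carrier_vec n"
  shows "(A *\<^sub>v u) \<bullet> v = u \<bullet> (A *\<^sub>v v)"
  using transpose_vec_mult_scalar[of A n n v u] assms by simp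

text \<open>Fewer than \<open>n\<close> linear conditions, padded with zero rows to a square matrix.
  Row \<open>k\<close> is zero, so the determinant vanishes and there is a nonzero kernel
  vector.\<close>

lemma exists_nonzero_orthogonal:
  fixes v :: "nat \<Rightarrow> real vec"
  assumes k: "k < n" and v: "\<And>i. i < k \<Longrightarrow> v i \<in> carrier_vec n"
  obtains x where "x \<in> carrier_vec n" "x \<noteq> 0\<^sub>v n" "\<And>i. i < k \<Longrightarrow> v i \<bullet> x = 0"
proof -
  define M where "M = mat n n (\<lambda>(i, j). if i < k then v i $ j else 0)"
  have M: "M \<in> carrier_mat n n" by (simp add: M_def)
  have "row M k = 0\<^sub>v n" using k by (intro eq_vecI) (auto simp: M_def)
  moreover have "M = mat\<^sub>r n n (row M)" using M by (intro eq_matI) auto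
  ultimately have "M = mat\<^sub>r n n (\<lambda>i. if i = k then 0\<^sub>v n else row M i)"
    using k by (auto intro!: eq_matI simp: M_def)
  moreover have "row M \<in> {0..<n} \<rightarrow> carrier_vec n" using M by auto
  ultimately have "det M = 0" using det_row_0[OF k, of "row M"] by simp
  then obtain x where x: "x \<in> carrier_vec n" "x \<noteq> 0\<^sub>v n" "M *\<^sub>v x = 0\<^sub>v n"
    using det_0_iff_vec_prod_zero[OF M] by auto
  have "v i \<bullet> x = 0" if "i < k" for i
  proof -
    have "row M i = v i" using that k v[OF that] by (intro eq_vecI) (auto simp: M_def)
    then have "v i \<bullet> x = (M *\<^sub>v x) $ i" using M that k by simp
    then show ?thesis using x that k by simp
  qed
  then show ?thesis using x that by blast
qed

text \<open>
  The compactness comes from the product topology on functions, into which vectors embed by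
  their coordinates.
\<close>

lemma exists_min_quadratic_form:
  fixes A :: "real mat" and v :: "nat \<Rightarrow> real vec"
  assumes A: "A \<in> carrier_mat n n" and k: "k < n"
    and v: "\<And>i. i < k \<Longrightarrow> v i \<in> carrier_vec n"
  defines "S \<equiv> {x \<in> carrier_vec n. x \<bullet> x = 1 \<and> (\<forall>i<k. v i \<bullet> x = 0)}"
  obtains x where "x \<in> S" "\<And>z. z \<in> S \<Longrightarrow> x \<bullet> (A *\<^sub>v x) \<le> z \<bullet> (A *\<^sub>v z)"
proof -
  define q where "q f = (\<Sum>i<n. f i * (\<Sum>j<n. A $$ (i, j) * f j))" for f :: "nat \<Rightarrow> real"
  have q: "q (($) x) = x \<bullet> (A *\<^sub>v x)" if "x \<in> carrier_vec n" for x
    using that A by (simp add: q_def scalar_prod_def lessThan_atLeast0)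
  \<comment> \<open>Coordinates from \<open>n\<close> on are pinned to 0, so that \<open>K\<close>
    is a product of compact sets over all of \<open>UNIV\<close> and Tychonoff applies.\<close>
  define K where "K = PiE UNIV (\<lambda>i. if i < n then {- 1..1} else {0 :: real})"
  define F where "F = (\<Inter>i<k. {f :: nat \<Rightarrow> real. (\<Sum>j<n. v i $ j * f j) = 0})"
  define G where "G = {f :: nat \<Rightarrow> real. (\<Sum>j<n. f j * f j) = 1}"
  have cont: "continuous_on UNIV (\<lambda>f :: nat \<Rightarrow> real. f i)" for i by simp
  have "compactin (product_topology (\<lambda>_. euclidean) UNIV) K"
    unfolding K_def by (subst compactin_PiE) auto
  then have "compact K" by (simp add: euclidean_product_topology)
  moreover have "closed F" unfolding F_def
    by (intro closed_INT ballI closed_Collect_eq continuous_intros) simp_all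
  moreover have "closed G" unfolding G_def
    by (intro closed_Collect_eq continuous_intros) simp_all
  ultimately have comp: "compact (K \<inter> F \<inter> G)" by (intro compact_Int_closed)
  have mem: "(\<lambda>i. if i < n then x $ i else 0) \<in> K \<inter> F \<inter> G" (is "?f \<in> _") if x: "x \<in> S" for x
  proof -
    have xx: "(\<Sum>j<n. x $ j * x $ j) = 1" and dim: "dim_vec x = n"
      using x by (auto simp: S_def scalar_prod_def lessThan_atLeast0)
    have "\<bar>x $ i\<bar> \<le> 1" if "i < n" for i
    proof -
      have "x $ i * x $ i \<le> (\<Sum>j<n. x $ j * x $ j)"
        using that by (intro member_le_sum[where f = "\<lambda>j. x $ j * x $ j"]) auto
      then have "(x $ i)\<^sup>2 \<le> 1" unfolding xx by (simp add: power2_eq_square)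
      then show ?thesis by (simp add: abs_square_le_1)
    qed
    then have "?f \<in> K" by (force simp: K_def abs_le_iff)
    moreover have "?f \<in> F" using x v
      by (auto simp: F_def S_def scalar_prod_def lessThan_atLeast0)
    moreover have "?f \<in> G" using xx by (simp add: G_def)
    ultimately show ?thesis by simp
  qed
  have q_mem: "q (\<lambda>i. if i < n then x $ i else 0) = x \<bullet> (A *\<^sub>v x)" if "x \<in> S" for x
    using that q[of x] by (simp add: q_def S_def)
  \<comment> \<open>A minimum is attained only on a nonempty set: the point comes from normalising a
    vector orthogonal to all \<open>v i\<close>.\<close>
  obtain x0 where x0: "x0 \<in> carrier_vec n" "x0 \<noteq> 0\<^sub>v n" "\<And>i. i < k \<Longrightarrow> v i \<bullet> x0 = 0"
    using exists_nonzero_orthogonal[of k n v] k v by blast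
  have "(1 / norm2 x0) \<cdot>\<^sub>v x0 \<in> S"
    using x0 v norm2_zero_iff[OF x0(1)] norm2_power2[of x0]
    by (auto simp: S_def power2_eq_square field_simps)
  then have "K \<inter> F \<inter> G \<noteq> {}" using mem by blast
  moreover have "continuous_on (K \<inter> F \<inter> G) q" unfolding q_def
    by (intro continuous_intros continuous_on_subset[OF cont]) auto
  ultimately obtain f where f: "f \<in> K \<inter> F \<inter> G" "\<And>g. g \<in> K \<inter> F \<inter> G \<Longrightarrow> q f \<le> q g"
    using continuous_attains_inf[OF comp] by blast
  define x where "x = vec n f"
  have "v i \<bullet> x = 0" if "i < k" for i
    using f(1) that by (auto simp: F_def x_def scalar_prod_def lessThan_atLeast0)
  moreover have "x \<bullet> x = 1"
    using f(1) by (auto simp: G_def x_def scalar_prod_def lessThan_atLeast0)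
  ultimately have xS: "x \<in> S" by (simp add: S_def x_def)
  have "q f = x \<bullet> (A *\<^sub>v x)" using q_mem[OF xS] by (simp add: x_def q_def)
  then show ?thesis using that[OF xS] f(2) mem q_mem by metis
qed

text \<open>Take \<open>x\<close> minimising the Rayleigh quotient on the orthogonal complement of
  the \<open>v i\<close>. By symmetry \<open>A\<close> maps this complement to itself, so the
  residual \<open>g = A x - \<mu> x\<close> is an admissible direction of variation, and minimality
  forces it to vanish.\<close>

lemma symmetric_mat_orthogonal_eigenvector:
  fixes A :: "real mat" and v :: "nat \<Rightarrow> real vec"
  assumes A: "A \<in> carrier_mat n n" "A\<^sup>T = A" and k: "k < n"
    and v: "\<And>i. i < k \<Longrightarrow> v i \<in> carrier_vec n"
    and eig: "\<And>i. i < k \<Longrightarrow> A *\<^sub>v v i = d i \<cdot>\<^sub>v v i"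
  obtains x \<mu> where "x \<in> carrier_vec n" "x \<bullet> x = 1" "\<And>i. i < k \<Longrightarrow> v i \<bullet> x = 0"
    "A *\<^sub>v x = \<mu> \<cdot>\<^sub>v x"
proof -
  obtain x where x: "x \<in> carrier_vec n" "x \<bullet> x = 1" "\<And>i. i < k \<Longrightarrow> v i \<bullet> x = 0"
    and xmin: "\<And>z. z \<in> carrier_vec n \<Longrightarrow> z \<bullet> z = 1 \<Longrightarrow> (\<And>i. i < k \<Longrightarrow> v i \<bullet> z = 0) \<Longrightarrow>
      x \<bullet> (A *\<^sub>v x) \<le> z \<bullet> (A *\<^sub>v z)"
    by (rule exists_min_quadratic_form[OF A(1) k v]) auto
  define \<mu> where "\<mu> = x \<bullet> (A *\<^sub>v x)"
  define g where "g = A *\<^sub>v x - \<mu> \<cdot>\<^sub>v x"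
  have Ax: "A *\<^sub>v x \<in> carrier_vec n" and g: "g \<in> carrier_vec n"
    using A x by (auto simp: g_def)
  have Ag: "A *\<^sub>v g \<in> carrier_vec n" using A g by auto
  have g_orth: "v i \<bullet> g = 0" if "i < k" for i
  proof -
    have "v i \<bullet> (A *\<^sub>v x) = d i * (v i \<bullet> x)"
      using scalar_prod_symmetric_mat[OF A v[OF that] x(1)] eig[OF that] v[OF that] x(1) by simp
    then show ?thesis using x that v[OF that] Ax
      by (simp add: g_def scalar_prod_minus_distrib[of _ n])
  qed
  have min: "\<mu> * (z \<bullet> z) \<le> z \<bullet> (A *\<^sub>v z)"
    if z: "z \<in> carrier_vec n" "\<And>i. i < k \<Longrightarrow> v i \<bullet> z = 0" for z
  proof (cases "z = 0\<^sub>v n")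
    case True
    then show ?thesis using A by simp
  next
    case False
    then have pos: "norm2 z > 0" using norm2_zero_iff[OF z(1)] norm2_nonneg[of z] by linarith
    define c where "c = 1 / norm2 z"
    have zz: "z \<bullet> z = (norm2 z)\<^sup>2" by (simp add: norm2_power2)
    have "\<mu> \<le> (c \<cdot>\<^sub>v z) \<bullet> (A *\<^sub>v (c \<cdot>\<^sub>v z))"
      unfolding \<mu>_def using z v pos zz
      by (intro xmin) (auto simp: c_def power2_eq_square)
    also have "\<dots> = c\<^sup>2 * (z \<bullet> (A *\<^sub>v z))"
      using A z by (simp add: mult_mat_vec power2_eq_square)
    finally show ?thesis using pos by (simp add: zz c_def field_simps)
  qed
  have gx: "g \<bullet> x = 0"
    using x(1,2) Ax comm_scalar_prod[OF Ax x(1)]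
    by (simp add: g_def \<mu>_def minus_scalar_prod_distrib[of _ n])
  have gAx: "g \<bullet> (A *\<^sub>v x) = g \<bullet> g"
  proof -
    have "A *\<^sub>v x = g + \<mu> \<cdot>\<^sub>v x" using A(1) Ax x(1) by (intro eq_vecI) (auto simp: g_def)
    then show ?thesis using g x gx by (simp add: scalar_prod_add_distrib[of _ n])
  qed
  \<comment> \<open>Minimality along \<open>x + s g\<close> forces the derivative \<open>2 (g \<bullet> g)\<close> at \<open>s = 0\<close> to vanish.\<close>
  have line: "0 \<le> 2 * s * (g \<bullet> g) + s\<^sup>2 * (g \<bullet> (A *\<^sub>v g) - \<mu> * (g \<bullet> g))" for s
  proof -
    define z where "z = x + s \<cdot>\<^sub>v g"
    have z: "z \<in> carrier_vec n" using x g by (simp add: z_def)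
    have "v i \<bullet> z = 0" if "i < k" for i
      using x g g_orth that v[OF that] by (simp add: z_def scalar_prod_add_distrib[of _ n])
    then have "\<mu> * (z \<bullet> z) \<le> z \<bullet> (A *\<^sub>v z)" using min z by blast
    moreover have "z \<bullet> z = 1 + s\<^sup>2 * (g \<bullet> g)"
      using x g gx comm_scalar_prod[OF x(1) g]
      by (simp add: z_def scalar_prod_add_distrib[of _ n] add_scalar_prod_distrib[of _ n]
          power2_eq_square)
    moreover have "z \<bullet> (A *\<^sub>v z) = \<mu> + 2 * s * (g \<bullet> g) + s\<^sup>2 * (g \<bullet> (A *\<^sub>v g))"
    proof -
      have "A *\<^sub>v z = A *\<^sub>v x + s \<cdot>\<^sub>v (A *\<^sub>v g)"
        using A x g by (simp add: z_def mult_add_distrib_mat_vec[of A n n] mult_mat_vec)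
      moreover have "x \<bullet> (A *\<^sub>v g) = g \<bullet> g"
        using scalar_prod_symmetric_mat[OF A x(1) g] comm_scalar_prod[OF Ax g] gAx by simp
      ultimately show ?thesis
        using x g Ax Ag gAx
        by (simp add: z_def scalar_prod_add_distrib[of _ n] add_scalar_prod_distrib[of _ n]
            power2_eq_square \<mu>_def algebra_simps)
    qed
    ultimately show ?thesis by (simp add: algebra_simps)
  qed
  have "g \<bullet> g = 0"
  proof (rule ccontr)
    assume "g \<bullet> g \<noteq> 0"
    then have pos: "g \<bullet> g > 0" using scalar_prod_self_nonneg[of g] by linarith
    define c where "c = g \<bullet> (A *\<^sub>v g) - \<mu> * (g \<bullet> g)"
    \<comment> \<open>Small enough that the quadratic term \<open>s * c\<close> stays below
      \<open>2 * (g \<bullet> g)\<close>; adding 1 keeps the denominator positive. Inserting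
      \<open>- s\<close> into \<open>line\<close> then gives a negative value.\<close>
    define s where "s = (g \<bullet> g) / (\<bar>c\<bar> + 1)"
    have s: "s > 0" using pos by (simp add: s_def add_nonneg_pos)
    have "s * c \<le> s * \<bar>c\<bar>" using s by (intro mult_left_mono) auto
    also have "\<dots> \<le> s * (\<bar>c\<bar> + 1)" using s by simp
    also have "\<dots> = g \<bullet> g" using abs_ge_zero[of c] by (simp add: s_def)
    finally have "s * (s * c - 2 * (g \<bullet> g)) < 0"
      using s pos by (intro mult_pos_neg) auto
    with line[of "- s"] show False by (simp add: c_def power2_eq_square algebra_simps)
  qed
  then have "g = 0\<^sub>v n" using norm2_zero_iff[OF g] by (simp add: norm2_def)
  have "A *\<^sub>v x = \<mu> \<cdot>\<^sub>v x"
  proof (rule eq_vecI)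
    fix i assume "i < dim_vec (\<mu> \<cdot>\<^sub>v x)"
    then have i: "i < n" using x by simp
    have "g $ i = 0" using \<open>g = 0\<^sub>v n\<close> i by simp
    then show "(A *\<^sub>v x) $ i = (\<mu> \<cdot>\<^sub>v x) $ i" using i Ax x(1) by (simp add: g_def)
  qed (use A Ax x in simp)
  then show ?thesis using that x by blast
qed

text \<open>With \<open>k = 0\<close> this is the spectral theorem. The version with a prescribed
  initial segment allows known kernel vectors to be the first members of the basis.\<close>

lemma symmetric_mat_extend_eigenbasis:
  fixes A :: "real mat" and v :: "nat \<Rightarrow> real vec"
  assumes A: "A \<in> carrier_mat n n" "A\<^sup>T = A" and k: "k \<le> n"
    and v: "\<And>i. i < k \<Longrightarrow> v i \<in> carrier_vec n"
    and eig: "\<And>i. i < k \<Longrightarrow> A *\<^sub>v v i = d i \<cdot>\<^sub>v v i"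
    and orth: "\<And>i j. i < k \<Longrightarrow> j < k \<Longrightarrow> v i \<bullet> v j = (if i = j then 1 else 0)"
  obtains v' d' where "\<And>i. i < k \<Longrightarrow> v' i = v i" "\<And>i. i < k \<Longrightarrow> d' i = d i"
    "\<And>i. i < n \<Longrightarrow> v' i \<in> carrier_vec n"
    "\<And>i. i < n \<Longrightarrow> A *\<^sub>v v' i = d' i \<cdot>\<^sub>v v' i"
    "\<And>i j. i < n \<Longrightarrow> j < n \<Longrightarrow> v' i \<bullet> v' j = (if i = j then 1 else 0)"
  using k v eig orth
proof (induction "n - k" arbitrary: k v d thesis)
  case 0
  from 0(1) have "k = n" using 0(3) by simp
  show ?case by (rule 0(2)[of v d]) (use 0(4-) \<open>k = n\<close> in auto)
next
  case (Suc m)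
  then have k: "k < n" by simp
  obtain x \<mu> where x: "x \<in> carrier_vec n" "x \<bullet> x = 1" "\<And>i. i < k \<Longrightarrow> v i \<bullet> x = 0"
    "A *\<^sub>v x = \<mu> \<cdot>\<^sub>v x"
    using symmetric_mat_orthogonal_eigenvector[OF A k, of v d] Suc.prems(3,4) by blast
  have x': "x \<bullet> v i = 0" if "i < k" for i
    using comm_scalar_prod[OF x(1) Suc.prems(3)[OF that]] x(3)[OF that] by simp
  show ?case
  proof (rule Suc.hyps(1)[of "Suc k" "v(k := x)" "d(k := \<mu>)"])
    show "m = n - Suc k" "Suc k \<le> n" using Suc.hyps(2) k by auto
    show "(v(k := x)) i \<in> carrier_vec n" if "i < Suc k" for i
      using that x Suc.prems(3) by (auto simp: less_Suc_eq)
    show "A *\<^sub>v (v(k := x)) i = (d(k := \<mu>)) i \<cdot>\<^sub>v (v(k := x)) i" if "i < Suc k" for i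
      using that x Suc.prems(4) by (auto simp: less_Suc_eq)
    show "(v(k := x)) i \<bullet> (v(k := x)) j = (if i = j then 1 else 0)"
      if "i < Suc k" "j < Suc k" for i j
      using that x x' Suc.prems(5) by (auto simp: less_Suc_eq)
  next
    fix v' d'
    assume "\<And>i. i < Suc k \<Longrightarrow> v' i = (v(k := x)) i" "\<And>i. i < Suc k \<Longrightarrow> d' i = (d(k := \<mu>)) i"
      "\<And>i. i < n \<Longrightarrow> v' i \<in> carrier_vec n"
      "\<And>i. i < n \<Longrightarrow> A *\<^sub>v v' i = d' i \<cdot>\<^sub>v v' i"
      "\<And>i j. i < n \<Longrightarrow> j < n \<Longrightarrow> v' i \<bullet> v' j = (if i = j then 1 else 0)"
    then show thesis by (intro Suc.prems(1)[of v' d']) auto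
  qed
qed

lemma proots_prod_linear: "proots (\<Prod>x\<leftarrow>xs. [:- d x, 1:]) = image_mset d (mset xs)"
  for d :: "'a \<Rightarrow> real"
proof (induction xs)
  case (Cons x xs)
  have "(\<Prod>x\<leftarrow>xs. [:- d x, 1:]) \<noteq> 0" by (auto simp: prod_list_zero_iff)
  then have "proots ([:- d x, 1:] * (\<Prod>x\<leftarrow>xs. [:- d x, 1:])) =
      proots [:- d x, 1:] + proots (\<Prod>x\<leftarrow>xs. [:- d x, 1:])"
    by (intro proots_mult) auto
  then show ?case using Cons by (simp del: mult_pCons_left)
qed simp

section \<open>Eigenbases, sorted characteristic roots and quadratic forms\<close>

context
  fixes A V :: "real mat" and n :: nat and v :: "nat \<Rightarrow> real vec" and d :: "nat \<Rightarrow> real"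
  assumes A: "A \<in> carrier_mat n n"
    and v: "\<And>i. i < n \<Longrightarrow> v i \<in> carrier_vec n"
    and eig: "\<And>i. i < n \<Longrightarrow> A *\<^sub>v v i = d i \<cdot>\<^sub>v v i"
    and orth: "\<And>i j. i < n \<Longrightarrow> j < n \<Longrightarrow> v i \<bullet> v j = (if i = j then 1 else 0)"
  defines "V \<equiv> mat n n (\<lambda>(i, j). v j $ i)"
begin

lemma eigenbasis_mat:
  shows "V \<in> carrier_mat n n" "V\<^sup>T * V = 1\<^sub>m n" "V * V\<^sup>T = 1\<^sub>m n" "A * V = V * mat_diag n d"
    "\<And>j. j < n \<Longrightarrow> col V j = v j"
proof -
  show V: "V \<in> carrier_mat n n" by (simp add: V_def)
  show col: "col V j = v j" if "j < n" for j
    using v[OF that] that by (intro eq_vecI) (auto simp: V_def)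
  show VV: "V\<^sup>T * V = 1\<^sub>m n"
    using V by (intro eq_matI) (auto simp: col orth)
  show "V * V\<^sup>T = 1\<^sub>m n"
    by (rule mat_mult_left_right_inverse[OF _ V VV]) (use V in simp)
  show "A * V = V * mat_diag n d"
  proof (rule eq_matI)
    fix i j assume "i < dim_row (V * mat_diag n d)" "j < dim_col (V * mat_diag n d)"
    then have ij: "i < n" "j < n" using V by (auto simp: mat_diag_def)
    have "(A * V) $$ (i, j) = (A *\<^sub>v v j) $ i" using A V ij by (simp add: col)
    also have "\<dots> = V $$ (i, j) * d j" using ij v[OF ij(2)] by (simp add: eig V_def)
    also have "\<dots> = (V * mat_diag n d) $$ (i, j)"
      using ij by (simp add: mat_diag_mult_right[OF V])
    finally show "(A * V) $$ (i, j) = (V * mat_diag n d) $$ (i, j)" .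
  qed (use A V in \<open>auto simp: mat_diag_def\<close>)
qed

text \<open>\<open>V\<close> is orthogonal, so \<open>A\<close> is similar to
  \<open>mat_diag n d\<close>, and the roots of the characteristic polynomial form the multiset of
  the \<open>d i\<close>. Sorting removes the dependence on the order of the basis.\<close>

lemma eigval_eigenbasis: "eigval A k = sort (map d [0..<n]) ! (k - 1)"
proof -
  note V = eigenbasis_mat
  have D: "mat_diag n d \<in> carrier_mat n n" by (simp add: mat_diag_def)
  have "A = A * (V * V\<^sup>T)" using A V by simp
  also have "\<dots> = A * V * V\<^sup>T" using A V(1) by (intro assoc_mult_mat[symmetric, of _ n n _ n _ n]) auto
  finally have "A = V * mat_diag n d * V\<^sup>T" unfolding V(4) .
  with A V(1-3) D have "similar_mat A (mat_diag n d)"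
    by (intro similar_matI[of _ _ V "V\<^sup>T" n])
      (simp_all only: insert_subset transpose_carrier_mat empty_subsetI simp_thms)
  then have "char_poly A = char_poly (mat_diag n d)" by (rule char_poly_similar)
  also have "\<dots> = (\<Prod>a \<leftarrow> diag_mat (mat_diag n d). [:- a, 1:])"
    by (rule char_poly_upper_triangular[OF D]) (auto simp: mat_diag_def)
  also have "diag_mat (mat_diag n d) = map d [0..<n]"
    by (auto simp: diag_mat_def mat_diag_def intro!: nth_equalityI)
  finally have "proots (char_poly A) = mset (map d [0..<n])"
    by (simp add: proots_prod_linear o_def)
  then show ?thesis by (simp only: eigval_def sorted_list_of_multiset_mset)
qed

lemma quadratic_form_eigenbasis:
  assumes w: "w \<in> carrier_vec n"
  shows "w \<bullet> (A *\<^sub>v w) = (\<Sum>i<n. d i * (v i \<bullet> w)\<^sup>2)" and "w \<bullet> w = (\<Sum>i<n. (v i \<bullet> w)\<^sup>2)"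
proof -
  note V = eigenbasis_mat
  define c where "c = V\<^sup>T *\<^sub>v w"
  have c: "c \<in> carrier_vec n" using V w by (simp add: c_def)
  have ci: "c $ i = v i \<bullet> w" if "i < n" for i
    using V that by (simp add: c_def)
  have wc: "w = V *\<^sub>v c"
    using V w assoc_mult_mat_vec[of V n n "V\<^sup>T" n w] by (simp add: c_def)
  have D: "mat_diag n d \<in> carrier_mat n n" by (simp add: mat_diag_def)
  have "A *\<^sub>v w = (A * V) *\<^sub>v c" using A V(1) c wc by simp
  also have "\<dots> = V *\<^sub>v (mat_diag n d *\<^sub>v c)"
    unfolding V(4) using V(1) D c by (rule assoc_mult_mat_vec)
  finally have "w \<bullet> (A *\<^sub>v w) = c \<bullet> (mat_diag n d *\<^sub>v c)"
    using transpose_vec_mult_scalar[OF V(1) mult_mat_vec_carrier[OF D c] w] by (simp add: c_def)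
  also have "\<dots> = (\<Sum>i<n. c $ i * (d i * c $ i))"
  proof -
    have "(mat_diag n d *\<^sub>v c) $ i = d i * c $ i" if "i < n" for i
    proof -
      have "(\<Sum>j = 0..<n. (if i = j then d j else 0) * c $ j) =
          (\<Sum>j = 0..<n. if i = j then d j * c $ j else 0)"
        by (intro sum.cong) auto
      then show ?thesis using that c by (simp add: mat_diag_def scalar_prod_def)
    qed
    then show ?thesis using D c
      by (simp add: scalar_prod_def lessThan_atLeast0 mat_diag_def del: index_mult_mat_vec)
  qed
  finally show "w \<bullet> (A *\<^sub>v w) = (\<Sum>i<n. d i * (v i \<bullet> w)\<^sup>2)"
    by (simp add: ci power2_eq_square mult_ac)
  have "c \<bullet> c = w \<bullet> w"
    using transpose_vec_mult_scalar[OF V(1) c w] unfolding wc[symmetric] c_def[symmetric] .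
  then show "w \<bullet> w = (\<Sum>i<n. (v i \<bullet> w)\<^sup>2)"
    using c by (simp add: scalar_prod_def[of c] lessThan_atLeast0 ci power2_eq_square flip: \<open>c \<bullet> c = w \<bullet> w\<close>)
qed

end

text \<open>A counting argument. If the entry at the 0-based position \<open>R\<close>, the (R+1)-th
  smallest, exceeded \<open>d j\<close>, at most \<open>R\<close> entries could be
  \<open>\<le> d j\<close>; but the \<open>R\<close> zeros and \<open>d j\<close> itself are
  \<open>R + 1\<close> such entries.\<close>

lemma sort_nth_le_of_zeros:
  fixes d :: "nat \<Rightarrow> real"
  assumes nonneg: "\<And>i. i < n \<Longrightarrow> 0 \<le> d i" and zero: "\<And>i. i < R \<Longrightarrow> d i = 0"
    and j: "R \<le> j" "j < n"
  shows "sort (map d [0..<n]) ! R \<le> d j"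
proof (rule ccontr)
  let ?s = "sort (map d [0..<n])"
  assume "\<not> ?s ! R \<le> d j"
  then have less: "d j < ?s ! R" by simp
  have len: "length ?s = n" by simp
  have "{i. i < n \<and> ?s ! i \<le> d j} \<subseteq> {..<R}"
  proof
    fix i assume i: "i \<in> {i. i < n \<and> ?s ! i \<le> d j}"
    show "i \<in> {..<R}"
    proof (rule ccontr)
      assume "i \<notin> {..<R}"
      then have "?s ! R \<le> ?s ! i" using i len by (intro sorted_nth_mono) auto
      then show False using less i by simp
    qed
  qed
  then have "card {i. i < n \<and> ?s ! i \<le> d j} \<le> R"
    using card_mono[of "{..<R}"] by fastforce
  moreover have "card {i. i < n \<and> ?s ! i \<le> d j} = card {i. i < n \<and> d i \<le> d j}"
  proof -
    have "length (filter (\<lambda>a. a \<le> d j) ?s) = length (filter (\<lambda>a. a \<le> d j) (map d [0..<n]))"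
      by (metis mset_filter mset_sort size_mset)
    then show ?thesis by (simp add: length_filter_conv_card cong: conj_cong)
  qed
  moreover have "insert j {..<R} \<subseteq> {i. i < n \<and> d i \<le> d j}"
    using j nonneg zero by auto
  then have "card (insert j {..<R}) \<le> card {i. i < n \<and> d i \<le> d j}"
    by (intro card_mono) auto
  ultimately show False using j by simp
qed

text \<open>The columns of \<open>T\<close> are extended to an eigenbasis. A vector orthogonal to
  them has only coefficients with index at least \<open>R\<close>, and the eigenvalues there are at
  least the (R+1)-th smallest. Should the kernel exceed the span of the columns, that eigenvalue is
  0 and the second claim is mere positive semidefiniteness.\<close>

lemma eigval_gap:
  fixes A T :: "real mat"
  assumes A: "A \<in> carrier_mat n n" "A\<^sup>T = A"
    and psd: "\<And>w. w \<in> carrier_vec n \<Longrightarrow> 0 \<le> w \<bullet> (A *\<^sub>v w)"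
    and T: "T \<in> carrier_mat n R" "T\<^sup>T * T = 1\<^sub>m R" "A * T = 0\<^sub>m n R" and R: "R < n"
  shows "0 \<le> eigval A (R + 1)"
    and "w \<in> carrier_vec n \<Longrightarrow> T\<^sup>T *\<^sub>v w = 0\<^sub>v R \<Longrightarrow> eigval A (R + 1) * (w \<bullet> w) \<le> w \<bullet> (A *\<^sub>v w)"
proof -
  have col_T: "A *\<^sub>v col T i = 0 \<cdot>\<^sub>v col T i" if "i < R" for i
  proof -
    have "A *\<^sub>v col T i = col (A * T) i" using A T(1) that by (intro col_mult2[symmetric]) auto
    also have "\<dots> = 0 \<cdot>\<^sub>v col T i" using T(1) that by (auto simp: T(3))
    finally show ?thesis .
  qed
  have orth_T: "col T i \<bullet> col T j = (if i = j then 1 else 0)" if "i < R" "j < R" for i j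
  proof -
    have "col T i \<bullet> col T j = (T\<^sup>T * T) $$ (i, j)" using T(1) that by simp
    then show ?thesis using that by (simp add: T(2))
  qed
  obtain v d where vT: "\<And>i. i < R \<Longrightarrow> v i = col T i" and d0: "\<And>i. i < R \<Longrightarrow> d i = 0"
    and v: "\<And>i. i < n \<Longrightarrow> v i \<in> carrier_vec n"
    and eig: "\<And>i. i < n \<Longrightarrow> A *\<^sub>v v i = d i \<cdot>\<^sub>v v i"
    and orth: "\<And>i j. i < n \<Longrightarrow> j < n \<Longrightarrow> v i \<bullet> v j = (if i = j then 1 else 0)"
    by (rule symmetric_mat_extend_eigenbasis[OF A, of R "col T" "\<lambda>_. 0"])
      (use R T col_T orth_T in \<open>auto simp: less_imp_le\<close>)
  have d_nonneg: "0 \<le> d i" if "i < n" for i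
    using psd[OF v[OF that]] eig[OF that] orth[OF that that] v[OF that] by simp
  have lam: "eigval A (R + 1) = sort (map d [0..<n]) ! R"
    using eigval_eigenbasis[OF A(1) v eig orth] by simp
  have "sort (map d [0..<n]) ! R \<in> set (sort (map d [0..<n]))"
    using R by (intro nth_mem) simp
  then show "0 \<le> eigval A (R + 1)" using d_nonneg lam by auto
  assume w: "w \<in> carrier_vec n" "T\<^sup>T *\<^sub>v w = 0\<^sub>v R"
  have "v i \<bullet> w = 0" if "i < R" for i
  proof -
    have "v i \<bullet> w = (T\<^sup>T *\<^sub>v w) $ i" using T(1) that by (simp add: vT)
    then show ?thesis using w that by simp
  qed
  then have "eigval A (R + 1) * (v i \<bullet> w)\<^sup>2 \<le> d i * (v i \<bullet> w)\<^sup>2" if "i < n" for i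
    using sort_nth_le_of_zeros[of n d R i] d_nonneg d0 that
    unfolding lam by (cases "i < R") (auto intro!: mult_right_mono)
  then have "(\<Sum>i<n. eigval A (R + 1) * (v i \<bullet> w)\<^sup>2) \<le> (\<Sum>i<n. d i * (v i \<bullet> w)\<^sup>2)"
    by (intro sum_mono) auto
  then show "eigval A (R + 1) * (w \<bullet> w) \<le> w \<bullet> (A *\<^sub>v w)"
    using quadratic_form_eigenbasis[OF A(1) v eig orth w(1)] by (simp add: sum_distrib_left)
qed

subsection \<open>Perturbed linear flows\<close>

text \<open>Multiply by \<open>exp (a * s)\<close> and replace the source by its largest value,
  which is at \<open>s = t\<close> when \<open>0 \<le> a\<close>. The bound \<open>t * K\<close>
  involves no division by \<open>a\<close>. The disjunction covers the three uses: growth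
  (\<open>K = 0\<close>, negative \<open>a\<close>), decay (\<open>a = 2 * lam\<close>) and drift
  (\<open>a = 0\<close>).\<close>

lemma gronwall_linear:
  fixes f f' :: "real \<Rightarrow> real"
  assumes t: "0 \<le> t" and K: "0 \<le> K" "K = 0 \<or> 0 \<le> a"
    and deriv: "\<And>s. (f has_real_derivative f' s) (at s)"
    and le: "\<And>s. 0 \<le> s \<Longrightarrow> s \<le> t \<Longrightarrow> f' s \<le> K - a * f s"
  shows "f t \<le> exp (- a * t) * f 0 + t * K"
proof -
  define h where "h s = exp (a * s) * f s - s * (exp (a * t) * K)" for s
  have "h t \<le> h 0"
  proof (rule DERIV_nonpos_imp_nonincreasing[OF t])
    fix s assume s: "0 \<le> s" "s \<le> t"
    have "(h has_real_derivative
        (exp (a * s) * (a * f s + f' s) - exp (a * t) * K)) (at s)"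
      unfolding h_def by (auto intro!: derivative_eq_intros deriv simp: algebra_simps)
    moreover have "exp (a * s) * (a * f s + f' s) \<le> exp (a * s) * K"
      using le[OF s] by (intro mult_left_mono) auto
    moreover have "exp (a * s) * K \<le> exp (a * t) * K"
      using K s by (cases "K = 0") (auto intro!: mult_left_mono)
    ultimately show "\<exists>y. (h has_real_derivative y) (at s) \<and> y \<le> 0"
      by (smt (verit, best))
  qed
  then have "exp (a * t) * f t \<le> f 0 + t * (exp (a * t) * K)" by (simp add: h_def)
  then have le': "exp (- a * t) * (exp (a * t) * f t)
      \<le> exp (- a * t) * (f 0 + t * (exp (a * t) * K))"
    by (intro mult_left_mono) auto
  have assoc: "exp (- a * t) * (exp (a * t) * f t) = exp (- a * t) * exp (a * t) * f t"
    "exp (- a * t) * (f 0 + t * (exp (a * t) * K)) =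
      exp (- a * t) * f 0 + t * (exp (- a * t) * exp (a * t) * K)"
    by (simp_all only: distrib_left mult_ac)
  have inv: "exp (- a * t) * exp (a * t) = 1" by (simp flip: exp_add)
  show ?thesis using le' unfolding assoc inv by simp
qed

lemma scalar_prod_has_derivative:
  fixes u v :: "real \<Rightarrow> real vec"
  assumes "\<And>s. u s \<in> carrier_vec n" "\<And>s. v s \<in> carrier_vec n"
    and "u' \<in> carrier_vec n" "v' \<in> carrier_vec n"
    and "\<And>i. i < n \<Longrightarrow> ((\<lambda>s. u s $ i) has_real_derivative u' $ i) (at s)"
    and "\<And>i. i < n \<Longrightarrow> ((\<lambda>s. v s $ i) has_real_derivative v' $ i) (at s)"
  shows "((\<lambda>s. u s \<bullet> v s) has_real_derivative (u' \<bullet> v s + u s \<bullet> v')) (at s)"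
proof -
  have "((\<lambda>s. \<Sum>i<n. u s $ i * v s $ i) has_real_derivative
      (\<Sum>i<n. u' $ i * v s $ i + v' $ i * u s $ i)) (at s)"
    using assms(5,6) by (intro DERIV_sum DERIV_mult) auto
  moreover have "u r \<bullet> v r = (\<Sum>i<n. u r $ i * v r $ i)" for r
    using assms(2)[of r] by (simp add: scalar_prod_def lessThan_atLeast0)
  moreover have "u' \<bullet> v s + u s \<bullet> v' = (\<Sum>i<n. u' $ i * v s $ i + v' $ i * u s $ i)"
    using assms(2)[of s] assms(4)
    by (simp add: scalar_prod_def lessThan_atLeast0 sum.distrib mult.commute)
  ultimately show ?thesis by simp
qed

lemma mult_mat_vec_has_derivative:
  fixes u :: "real \<Rightarrow> real vec"
  assumes A: "A \<in> carrier_mat m n" and u: "\<And>s. u s \<in> carrier_vec n" "u' \<in> carrier_vec n"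
    and deriv: "\<And>j. j < n \<Longrightarrow> ((\<lambda>s. u s $ j) has_real_derivative u' $ j) (at s)"
    and i: "i < m"
  shows "((\<lambda>s. (A *\<^sub>v u s) $ i) has_real_derivative (A *\<^sub>v u') $ i) (at s)"
  using scalar_prod_has_derivative[of "\<lambda>_. row A i" n u "0\<^sub>v n" u' s] A u deriv i by auto

text \<open>Serves for two bases: the normalised component indicators and an arbitrary orthonormal
  basis of the kernel.\<close>

locale orthonormal_columns =
  fixes T :: "real mat" and n R :: nat
  assumes T: "T \<in> carrier_mat n R" and TT: "T\<^sup>T * T = 1\<^sub>m R"
begin

definition proj :: "real vec \<Rightarrow> real vec" where
  "proj x = T *\<^sub>v (T\<^sup>T *\<^sub>v x)"

lemma proj_carrier [simp]: "proj x \<in> carrier_vec n"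
  and transpose_mult_carrier [simp]: "T\<^sup>T *\<^sub>v x \<in> carrier_vec R"
  using T by (simp_all add: proj_def carrier_vecI)

lemma dim_proj [simp]: "dim_vec (proj x) = n"
  using T by (simp add: proj_def)

lemma transpose_mult_mult: "q \<in> carrier_vec R \<Longrightarrow> T\<^sup>T *\<^sub>v (T *\<^sub>v q) = q"
  using T TT assoc_mult_mat_vec[of "T\<^sup>T" R n T R q] by simp

lemma transpose_mult_proj: "T\<^sup>T *\<^sub>v proj x = T\<^sup>T *\<^sub>v x"
  by (simp add: proj_def transpose_mult_mult)

lemma scalar_prod_proj:
  assumes "x \<in> carrier_vec n" "z \<in> carrier_vec n"
  shows "proj x \<bullet> z = (T\<^sup>T *\<^sub>v x) \<bullet> (T\<^sup>T *\<^sub>v z)"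
  using transpose_vec_mult_scalar[OF T transpose_mult_carrier[of x] assms(2)] assms T
  by (simp add: proj_def comm_scalar_prod[of _ n] comm_scalar_prod[of _ R])

lemma scalar_prod_proj_proj:
  assumes "x \<in> carrier_vec n" "z \<in> carrier_vec n"
  shows "proj x \<bullet> proj z = proj x \<bullet> z"
  using assms by (simp add: scalar_prod_proj transpose_mult_proj)

lemma proj_diff:
  assumes "x \<in> carrier_vec n" "z \<in> carrier_vec n"
  shows "proj (x - z) = proj x - proj z"
  using T assms by (simp add: proj_def mult_minus_distrib_mat_vec[of _ R n]
      mult_minus_distrib_mat_vec[of _ n R])

text \<open>Pythagoras, with the projection measured by its coordinates
  \<open>T\<^sup>T *\<^sub>v x\<close>; in this form the product rule yields the time derivative of
  the squared distance.\<close>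

lemma norm2_diff_proj_power2:
  assumes "x \<in> carrier_vec n"
  shows "(x - proj x) \<bullet> (x - proj x) = x \<bullet> x - (T\<^sup>T *\<^sub>v x) \<bullet> (T\<^sup>T *\<^sub>v x)"
  using assms
  by (simp add: minus_scalar_prod_distrib[of _ n] scalar_prod_minus_distrib[of _ n]
      comm_scalar_prod[of x n "proj x"] scalar_prod_proj_proj) (simp add: scalar_prod_proj)

lemma norm2_diff_proj_le:
  assumes "x \<in> carrier_vec n"
  shows "norm2 (x - proj x) \<le> norm2 x"
  unfolding norm2_def using norm2_diff_proj_power2[OF assms] by simp

text \<open>Best approximation: \<open>proj\<close> fixes \<open>T *\<^sub>v q\<close>, so the
  left-hand vector arises from \<open>x - T *\<^sub>v q\<close> by subtracting its projection, which
  does not increase the norm.\<close>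

lemma norm2_diff_proj_le_diff:
  assumes x: "x \<in> carrier_vec n" and q: "q \<in> carrier_vec R"
  shows "norm2 (x - proj x) \<le> norm2 (x - T *\<^sub>v q)"
proof -
  have Tq: "T *\<^sub>v q \<in> carrier_vec n" using T q by simp
  have "proj (T *\<^sub>v q) = T *\<^sub>v q" using q by (simp add: proj_def transpose_mult_mult)
  then have "x - proj x = (x - T *\<^sub>v q) - proj (x - T *\<^sub>v q)"
    using x Tq T by (subst proj_diff) (auto intro!: eq_vecI)
  then show ?thesis using norm2_diff_proj_le[of "x - T *\<^sub>v q"] x Tq by simp
qed

end

text \<open>\<open>B\<close> is the ideal generator: symmetric, zero on the columns of
  \<open>T\<close>, with form at least \<open>lam\<close> on their complement. The actual generator
  \<open>A\<close> is known only to be within \<open>d\<close> of \<open>B\<close>, with no sign or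
  symmetry of its own.\<close>

locale perturbed_flow = orthonormal_columns +
  fixes A B :: "real mat" and lam d t :: real and u :: "real \<Rightarrow> real vec"
  assumes A: "A \<in> carrier_mat n n" and B: "B \<in> carrier_mat n n" "B\<^sup>T = B"
    and BT: "B * T = 0\<^sub>m n R"
    and lam: "0 \<le> lam"
    and gap: "\<And>w. w \<in> carrier_vec n \<Longrightarrow> T\<^sup>T *\<^sub>v w = 0\<^sub>v R \<Longrightarrow> lam * (w \<bullet> w) \<le> w \<bullet> (B *\<^sub>v w)"
    and pert: "\<And>x. x \<in> carrier_vec n \<Longrightarrow> norm2 (A *\<^sub>v x - B *\<^sub>v x) \<le> d * norm2 x"
    and d: "0 \<le> d" and t: "0 \<le> t"
    and u: "\<And>s. u s \<in> carrier_vec n"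
    and ode: "\<And>s i. i < n \<Longrightarrow> ((\<lambda>s. u s $ i) has_real_derivative - (A *\<^sub>v u s) $ i) (at s)"
begin

lemma ode_uminus: "i < n \<Longrightarrow> ((\<lambda>s. u s $ i) has_real_derivative (- (A *\<^sub>v u s)) $ i) (at s)"
  using ode[of i s] A by simp

lemma A_u: "A *\<^sub>v u s \<in> carrier_vec n"
  using A u by simp

lemma energy_deriv:
  "((\<lambda>s. u s \<bullet> u s) has_real_derivative - 2 * (u s \<bullet> (A *\<^sub>v u s))) (at s)"
proof -
  have "((\<lambda>s. u s \<bullet> u s) has_real_derivative
      (- (A *\<^sub>v u s)) \<bullet> u s + u s \<bullet> (- (A *\<^sub>v u s))) (at s)"
    using A_u by (intro scalar_prod_has_derivative[of _ n] u ode_uminus) auto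
  then show ?thesis
    using carrier_vecD[OF u] carrier_vecD[OF A_u] comm_scalar_prod[OF u A_u]
    by (simp del: dim_mult_mat_vec)
qed

lemma mult_split:
  assumes "x \<in> carrier_vec n" "z \<in> carrier_vec n"
  shows "z \<bullet> (A *\<^sub>v x) = z \<bullet> (B *\<^sub>v x) + z \<bullet> (A *\<^sub>v x - B *\<^sub>v x)"
  using assms A B by (simp add: scalar_prod_minus_distrib[of _ n])

lemma pert_scalar_prod:
  assumes "x \<in> carrier_vec n" "z \<in> carrier_vec n"
  shows "\<bar>z \<bullet> (A *\<^sub>v x - B *\<^sub>v x)\<bar> \<le> d * norm2 x * norm2 z"
proof -
  have "\<bar>z \<bullet> (A *\<^sub>v x - B *\<^sub>v x)\<bar> \<le> norm2 z * norm2 (A *\<^sub>v x - B *\<^sub>v x)"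
    using assms A B by (intro abs_scalar_prod_le[of _ n]) auto
  also have "\<dots> \<le> norm2 z * (d * norm2 x)"
    using assms by (intro mult_left_mono pert) auto
  finally show ?thesis by (simp add: mult_ac)
qed

lemma B_proj: "B *\<^sub>v proj x = 0\<^sub>v n"
proof -
  have "B *\<^sub>v proj x = (B * T) *\<^sub>v (T\<^sup>T *\<^sub>v x)"
    unfolding proj_def using B T by (intro assoc_mult_mat_vec[symmetric]) auto
  moreover have "0\<^sub>m n R *\<^sub>v z = 0\<^sub>v n" if "z \<in> carrier_vec R" for z :: "real vec"
    using that by auto
  ultimately show ?thesis by (simp add: BT)
qed

lemma scalar_prod_B_symmetric:
  "x \<in> carrier_vec n \<Longrightarrow> z \<in> carrier_vec n \<Longrightarrow> z \<bullet> (B *\<^sub>v x) = (B *\<^sub>v z) \<bullet> x"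
  using transpose_vec_mult_scalar[OF B(1), of x z] B by simp

lemma proj_scalar_prod_B: "x \<in> carrier_vec n \<Longrightarrow> z \<in> carrier_vec n \<Longrightarrow> proj z \<bullet> (B *\<^sub>v x) = 0"
  by (simp add: scalar_prod_B_symmetric B_proj)

text \<open>\<open>B\<close> kills the range of \<open>proj\<close> and, being symmetric, maps into
  its complement. So its form sees only the orthogonal part \<open>w\<close>. Together with
  \<open>0 \<le> lam\<close>, the two claims make the form of \<open>B\<close> nonnegative.\<close>

lemma B_form_ge:
  assumes x: "x \<in> carrier_vec n"
  defines "w \<equiv> x - proj x"
  shows "w \<bullet> (B *\<^sub>v x) \<ge> lam * (w \<bullet> w)" and "w \<bullet> (B *\<^sub>v x) = x \<bullet> (B *\<^sub>v x)"
proof -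
  have w: "w \<in> carrier_vec n" using x by (simp add: w_def)
  have "B *\<^sub>v x = B *\<^sub>v w"
    using x B by (simp add: w_def mult_minus_distrib_mat_vec[of _ n n] B_proj)
  moreover have "T\<^sup>T *\<^sub>v w = 0\<^sub>v R"
    using x T by (simp add: w_def mult_minus_distrib_mat_vec[of _ R n] transpose_mult_proj)
  ultimately show "w \<bullet> (B *\<^sub>v x) \<ge> lam * (w \<bullet> w)" using gap[OF w] by simp
  show "w \<bullet> (B *\<^sub>v x) = x \<bullet> (B *\<^sub>v x)"
    using x B by (simp add: w_def minus_scalar_prod_distrib[of _ n] proj_scalar_prod_B)
qed

text \<open>The form of \<open>A\<close> is at least \<open>- d\<close> times the squared norm,
  since that of \<open>B\<close> is nonnegative. Hence the energy grows at most at rate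
  \<open>2 * d\<close>; the bound is relaxed to time \<open>t\<close> to be uniform in
  \<open>s\<close>.\<close>

lemma flow_growth:
  assumes "0 \<le> s" "s \<le> t"
  shows "norm2 (u s) \<le> exp (t * d) * norm2 (u 0)"
proof -
  have "u s \<bullet> u s \<le> exp (- (- 2 * d) * s) * (u 0 \<bullet> u 0) + s * 0"
  proof (rule gronwall_linear[where f = "\<lambda>s. u s \<bullet> u s" and f' = "\<lambda>s. - 2 * (u s \<bullet> (A *\<^sub>v u s))"])
    fix r
    show "((\<lambda>s. u s \<bullet> u s) has_real_derivative - 2 * (u r \<bullet> (A *\<^sub>v u r))) (at r)"
      by (rule energy_deriv)
    have "u r \<bullet> (B *\<^sub>v u r) \<ge> 0"
      using B_form_ge[OF u[of r]] lam
      by (smt (verit) mult_nonneg_nonneg scalar_prod_self_nonneg)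
    moreover have "\<bar>u r \<bullet> (A *\<^sub>v u r - B *\<^sub>v u r)\<bar> \<le> d * (u r \<bullet> u r)"
      using pert_scalar_prod[OF u[of r] u[of r]]
      by (simp add: power2_eq_square mult.assoc flip: norm2_power2)
    ultimately show "- 2 * (u r \<bullet> (A *\<^sub>v u r)) \<le> 0 - (- 2 * d) * (u r \<bullet> u r)"
      using mult_split[OF u[of r] u[of r]] by simp
  qed (use assms in auto)
  also have "exp (- (- 2 * d) * s) = (exp (s * d))\<^sup>2"
    by (simp add: power2_eq_square flip: exp_add)
  finally have "(norm2 (u s))\<^sup>2 \<le> (exp (s * d) * norm2 (u 0))\<^sup>2"
    by (simp add: norm2_power2 power_mult_distrib)
  then have "norm2 (u s) \<le> exp (s * d) * norm2 (u 0)"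
    by (rule power2_le_imp_le) simp
  also have "\<dots> \<le> exp (t * d) * norm2 (u 0)"
    using assms d by (intro mult_right_mono) (auto intro: mult_right_mono)
  finally show ?thesis .
qed

text \<open>For the orthogonal part \<open>w\<close>, the derivative of \<open>w \<bullet> w\<close>
  is \<open>- 2 * (w \<bullet> (A *\<^sub>v u))\<close>. Its \<open>B\<close> part gives decay at
  rate \<open>2 * lam\<close>; the rest is at most \<open>2 * d * M\<^sup>2\<close>, because both
  \<open>u\<close> and \<open>w\<close> stay below \<open>M\<close>.\<close>

lemma flow_near_proj:
  "norm2 (u t - proj (u t)) \<le>
    sqrt (exp (- 2 * (t * lam)) + 2 * (t * d) * (exp (t * d))\<^sup>2) * norm2 (u 0)"
proof -
  define M where "M = exp (t * d) * norm2 (u 0)"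
  define w where "w s = u s - proj (u s)" for s
  have w: "w s \<in> carrier_vec n" for s using u by (simp add: w_def)
  have "w t \<bullet> w t \<le> exp (- (2 * lam) * t) * (w 0 \<bullet> w 0) + t * (2 * d * M\<^sup>2)"
  proof (rule gronwall_linear[where f = "\<lambda>s. w s \<bullet> w s" and f' = "\<lambda>s. - 2 * (w s \<bullet> (A *\<^sub>v u s))"])
    fix s
    let ?c = "\<lambda>s. T\<^sup>T *\<^sub>v u s" and ?a = "A *\<^sub>v u s"
    have a: "?a \<in> carrier_vec n" by (rule A_u)
    have "((\<lambda>s. ?c s \<bullet> ?c s) has_real_derivative
        (T\<^sup>T *\<^sub>v - ?a) \<bullet> ?c s + ?c s \<bullet> (T\<^sup>T *\<^sub>v - ?a)) (at s)"
      using T u a ode_uminus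
      by (intro scalar_prod_has_derivative[of _ R] mult_mat_vec_has_derivative[of _ R n]) auto
    moreover have "T\<^sup>T *\<^sub>v - z = - (T\<^sup>T *\<^sub>v z)" if "z \<in> carrier_vec n" for z
      using T that by (intro eq_vecI) auto
    note this[OF a]
    ultimately have deriv: "((\<lambda>s. w s \<bullet> w s) has_real_derivative
        (- 2 * (u s \<bullet> ?a) - (- 2 * (?c s \<bullet> (T\<^sup>T *\<^sub>v ?a))))) (at s)"
      unfolding w_def norm2_diff_proj_power2[OF u]
      by (intro DERIV_diff energy_deriv) (simp_all add: comm_scalar_prod[of "T\<^sup>T *\<^sub>v ?a" R])
    have "- 2 * (u s \<bullet> ?a) - (- 2 * (?c s \<bullet> (T\<^sup>T *\<^sub>v ?a))) = - 2 * (w s \<bullet> ?a)"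
      using u a by (simp add: w_def minus_scalar_prod_distrib[of _ n] scalar_prod_proj)
    with deriv show "((\<lambda>s. w s \<bullet> w s) has_real_derivative - 2 * (w s \<bullet> ?a)) (at s)"
      by (simp only:)
    assume s: "0 \<le> s" "s \<le> t"
    have "\<bar>w s \<bullet> (?a - B *\<^sub>v u s)\<bar> \<le> d * norm2 (u s) * norm2 (w s)"
      by (rule pert_scalar_prod[OF u w])
    also have "\<dots> \<le> d * M * M"
    proof (intro mult_mono)
      show "norm2 (u s) \<le> M" using flow_growth[OF s] by (simp add: M_def)
      then show "norm2 (w s) \<le> M"
        using norm2_diff_proj_le[OF u[of s]] by (simp add: w_def)
    qed (use d in \<open>auto simp: M_def\<close>)
    finally show "- 2 * (w s \<bullet> ?a) \<le> 2 * d * M\<^sup>2 - 2 * lam * (w s \<bullet> w s)"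
      using mult_split[OF u[of s] w[of s]] B_form_ge(1)[OF u[of s]]
      by (simp add: w_def power2_eq_square)
  qed (use t d lam in auto)
  also have "\<dots> \<le> exp (- (2 * lam) * t) * (u 0 \<bullet> u 0) + t * (2 * d * M\<^sup>2)"
    using norm2_diff_proj_power2[OF u[of 0]] by (simp add: w_def)
  also have "\<dots> = (exp (- 2 * (t * lam)) + 2 * (t * d) * (exp (t * d))\<^sup>2) * (norm2 (u 0))\<^sup>2"
    by (simp add: M_def norm2_power2 power_mult_distrib algebra_simps)
  finally have "norm2 (w t) \<le>
      sqrt ((exp (- 2 * (t * lam)) + 2 * (t * d) * (exp (t * d))\<^sup>2) * (norm2 (u 0))\<^sup>2)"
    unfolding norm2_power2[symmetric, of "w t"] by (rule real_le_rsqrt)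
  then show ?thesis by (simp add: w_def real_sqrt_mult)
qed

text \<open>
  Along the fixed direction \<open>x = proj (u t - u 0)\<close> only the perturbation contributes to the
  derivative of \<open>x \<bullet> u s\<close>, and its total increment is \<open>x \<bullet> x\<close>.
\<close>

lemma flow_proj_drift: "norm2 (proj (u t - u 0)) \<le> t * d * exp (t * d) * norm2 (u 0)"
proof -
  define x where "x = proj (u t - u 0)"
  define M where "M = exp (t * d) * norm2 (u 0)"
  have x: "x \<in> carrier_vec n" using u by (simp add: x_def)
  have deriv: "((\<lambda>s. x \<bullet> u s) has_real_derivative - (x \<bullet> (A *\<^sub>v u s))) (at s)" for s
    using scalar_prod_has_derivative[of "\<lambda>_. x" n u "0\<^sub>v n" "- (A *\<^sub>v u s)" s] x u A ode_uminus
    by simp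
  \<comment> \<open>With rate 0 the Gronwall bound is a mean value inequality.\<close>
  have "x \<bullet> u t \<le> exp (- 0 * t) * (x \<bullet> u 0) + t * (d * M * norm2 x)"
    using x
  proof (intro gronwall_linear[OF _ _ _ deriv])
    fix s assume s: "0 \<le> s" "s \<le> t"
    have "x \<bullet> (A *\<^sub>v u s) = x \<bullet> (A *\<^sub>v u s - B *\<^sub>v u s)"
      using mult_split[OF u[of s] x] proj_scalar_prod_B[OF u[of s], of "u t - u 0"] u
      by (simp add: x_def)
    also have "\<bar>\<dots>\<bar> \<le> d * norm2 (u s) * norm2 x" by (rule pert_scalar_prod[OF u x])
    also have "\<dots> \<le> d * M * norm2 x"
      using flow_growth[OF s] d by (intro mult_right_mono mult_left_mono) (auto simp: M_def)
    finally show "- (x \<bullet> (A *\<^sub>v u s)) \<le> d * M * norm2 x - 0 * (x \<bullet> u s)" by simp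
  qed (use d t in \<open>auto simp: M_def\<close>)
  moreover have "x \<bullet> u t - x \<bullet> u 0 = (norm2 x)\<^sup>2"
    using u x scalar_prod_proj_proj[of "u t - u 0" "u t - u 0"]
    by (simp add: norm2_power2 flip: scalar_prod_minus_distrib[of _ n]) (simp add: x_def)
  ultimately have "norm2 x * norm2 x \<le> (t * d * M) * norm2 x"
    by (simp add: power2_eq_square algebra_simps)
  moreover have "0 \<le> t * d * M" using t d by (simp add: M_def)
  ultimately have "norm2 x \<le> t * d * M"
    by (cases "norm2 x = 0") (use norm2_nonneg[of x] in auto)
  then show ?thesis by (simp add: x_def M_def mult_ac)
qed

lemma flow_limit:
  defines "\<epsilon> \<equiv> sqrt (exp (- 2 * (t * lam)) + 2 * (t * d) * (exp (t * d))\<^sup>2)"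
  shows "norm2 (u t - proj (u 0)) \<le> (\<epsilon> + t * d * exp (t * d)) * norm2 (u 0)"
proof -
  have "u t - proj (u 0) = (u t - proj (u t)) + proj (u t - u 0)"
    using u carrier_vecD[OF u]
    by (intro eq_vecI) (auto simp: proj_diff)
  then have "norm2 (u t - proj (u 0)) \<le> norm2 (u t - proj (u t)) + norm2 (proj (u t - u 0))"
    using norm2_add_le[of "u t - proj (u t)" n "proj (u t - u 0)"] u by simp
  then show ?thesis using flow_near_proj flow_proj_drift by (simp add: \<epsilon>_def distrib_right)
qed

end

subsection \<open>Graph Laplacians and connected components\<close>

lemma laplacian_carrier [simp]: "A \<in> carrier_mat n n \<Longrightarrow> laplacian A \<in> carrier_mat n n"
  by (auto simp: laplacian_def degree_matrix_def)

lemma dim_laplacian [simp]: "dim_row (laplacian A) = dim_row A" "dim_col (laplacian A) = dim_col A"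
  by (simp_all add: laplacian_def)

lemma laplacian_index:
  assumes "A \<in> carrier_mat n n" "i < n" "j < n"
  shows "laplacian A $$ (i, j) = (if i = j then \<Sum>k<n. A $$ (k, j) else 0) - A $$ (i, j)"
  using assms by (auto simp: laplacian_def degree_matrix_def mat_diag_def)

lemma laplacian_minus:
  assumes "A \<in> carrier_mat n n" "B \<in> carrier_mat n n"
  shows "laplacian (A - B) = laplacian A - laplacian B"
proof (rule eq_matI)
  fix i j assume "i < dim_row (laplacian A - laplacian B)" "j < dim_col (laplacian A - laplacian B)"
  then have ij: "i < n" "j < n" using laplacian_carrier[OF assms(2)] by auto
  have AB: "A - B \<in> carrier_mat n n" using assms by auto
  show "laplacian (A - B) $$ (i, j) = (laplacian A - laplacian B) $$ (i, j)"
    using assms ij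
    by (simp add: laplacian_index[OF AB] laplacian_index[OF assms(1)] laplacian_index[OF assms(2)]
        sum_subtractf)
qed simp_all

lemma laplacian_smult:
  assumes "A \<in> carrier_mat n n"
  shows "laplacian (c \<cdot>\<^sub>m A) = c \<cdot>\<^sub>m laplacian A"
proof (rule eq_matI)
  fix i j assume "i < dim_row (c \<cdot>\<^sub>m laplacian A)" "j < dim_col (c \<cdot>\<^sub>m laplacian A)"
  then have ij: "i < n" "j < n" using laplacian_carrier[OF assms] by auto
  have cA: "c \<cdot>\<^sub>m A \<in> carrier_mat n n" using assms by auto
  show "laplacian (c \<cdot>\<^sub>m A) $$ (i, j) = (c \<cdot>\<^sub>m laplacian A) $$ (i, j)"
    using assms ij
    by (simp add: laplacian_index[OF cA] laplacian_index[OF assms] algebra_simps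
        flip: sum_distrib_left)
qed simp_all

lemma symmetric_mat_index:
  assumes "A \<in> carrier_mat n n" "A\<^sup>T = A" "i < n" "j < n"
  shows "A $$ (j, i) = A $$ (i, j)"
  using assms index_transpose_mat(1)[of i A j] by simp

lemma laplacian_symmetric:
  assumes A: "A \<in> carrier_mat n n" "A\<^sup>T = A"
  shows "(laplacian A)\<^sup>T = laplacian A"
  using A(1) symmetric_mat_index[OF A]
  by (intro eq_matI) (auto simp: laplacian_index[OF A(1)])

text \<open>In this difference form the diagonal of \<open>A\<close> cancels. Symmetry is what turns
  the column sums of \<open>degree_matrix\<close> into row sums.\<close>

lemma laplacian_mult_vec:
  assumes A: "A \<in> carrier_mat n n" "A\<^sup>T = A" and x: "x \<in> carrier_vec n" and i: "i < n"
  shows "(laplacian A *\<^sub>v x) $ i = (\<Sum>j<n. A $$ (i, j) * (x $ i - x $ j))"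
proof -
  have "(laplacian A *\<^sub>v x) $ i = (\<Sum>j<n. laplacian A $$ (i, j) * x $ j)"
    using A(1) x i by (simp add: scalar_prod_def lessThan_atLeast0)
  also have "\<dots> = (\<Sum>j<n. (if i = j then (\<Sum>k<n. A $$ (k, i)) * x $ i else 0) - A $$ (i, j) * x $ j)"
    using i by (intro sum.cong) (auto simp: laplacian_index[OF A(1)] algebra_simps)
  also have "\<dots> = (\<Sum>k<n. A $$ (k, i)) * x $ i - (\<Sum>j<n. A $$ (i, j) * x $ j)"
    using i by (simp add: sum_subtractf)
  also have "(\<Sum>k<n. A $$ (k, i)) = (\<Sum>k<n. A $$ (i, k))"
    using symmetric_mat_index[OF A] i by (intro sum.cong) auto
  finally show ?thesis by (simp add: sum_distrib_right sum_subtractf right_diff_distrib)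
qed

text \<open>Averaging the double sum with its transpose gives the Dirichlet form: twice the
  quadratic form is the sum of \<open>A $$ (i, j) * (x $ i - x $ j)\<^sup>2\<close>.\<close>

lemma laplacian_psd:
  assumes A: "weighted_adjacency n A" and x: "x \<in> carrier_vec n"
  shows "0 \<le> x \<bullet> (laplacian A *\<^sub>v x)"
proof -
  have A': "A \<in> carrier_mat n n" "A\<^sup>T = A" and nonneg: "\<And>i j. i < n \<Longrightarrow> j < n \<Longrightarrow> 0 \<le> A $$ (i, j)"
    using A by (auto simp: weighted_adjacency_def)
  let ?f = "\<lambda>i j. A $$ (i, j) * (x $ i * (x $ i - x $ j))"
  have "x \<bullet> (laplacian A *\<^sub>v x) = (\<Sum>i<n. x $ i * (laplacian A *\<^sub>v x) $ i)"
    using A'(1) by (simp add: scalar_prod_def lessThan_atLeast0 del: index_mult_mat_vec)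
  also have "\<dots> = (\<Sum>i<n. \<Sum>j<n. ?f i j)"
    by (simp add: laplacian_mult_vec[OF A' x] sum_distrib_left mult_ac del: index_mult_mat_vec)
  finally have e1: "x \<bullet> (laplacian A *\<^sub>v x) = (\<Sum>i<n. \<Sum>j<n. ?f i j)" .
  also have "\<dots> = (\<Sum>i<n. \<Sum>j<n. ?f j i)" by (rule sum.swap)
  also have "\<dots> = (\<Sum>i<n. \<Sum>j<n. A $$ (i, j) * (x $ j * (x $ j - x $ i)))"
    using symmetric_mat_index[OF A'] by (intro sum.cong) auto
  finally have "2 * (x \<bullet> (laplacian A *\<^sub>v x)) =
      (\<Sum>i<n. \<Sum>j<n. ?f i j) + (\<Sum>i<n. \<Sum>j<n. A $$ (i, j) * (x $ j * (x $ j - x $ i)))"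
    using e1 by simp
  also have "\<dots> = (\<Sum>i<n. \<Sum>j<n. A $$ (i, j) * (x $ i - x $ j)\<^sup>2)"
    by (simp add: power2_eq_square algebra_simps flip: sum.distrib)
  also have "0 \<le> \<dots>" using nonneg by (intro sum_nonneg mult_nonneg_nonneg) auto
  finally show ?thesis by simp
qed

lemma laplacian_locally_constant:
  assumes A: "A \<in> carrier_mat n n" "A\<^sup>T = A" and x: "x \<in> carrier_vec n"
    and const: "\<And>i j. (i, j) \<in> adjacent A \<Longrightarrow> x $ i = x $ j"
  shows "laplacian A *\<^sub>v x = 0\<^sub>v n"
proof (rule eq_vecI)
  fix i assume "i < dim_vec (0\<^sub>v n)"
  then have i: "i < n" by simp
  have "A $$ (i, j) * (x $ i - x $ j) = 0" if "j < n" for j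
    using const[of i j] i that A(1) by (cases "i = j") (auto simp: adjacent_def)
  then show "(laplacian A *\<^sub>v x) $ i = 0\<^sub>v n $ i"
    unfolding laplacian_mult_vec[OF A x i] using i by (simp add: sum.neutral)
qed (use A(1) in auto)

text \<open>The closure is reflexive on all natural numbers; cutting it down to the vertex set makes
  it an equivalence there, with symmetry inherited from the matrix.\<close>

lemma equiv_components:
  assumes A: "A \<in> carrier_mat n n" "A\<^sup>T = A"
  shows "equiv {..<dim_row A} ((adjacent A)\<^sup>* \<inter> {..<dim_row A} \<times> {..<dim_row A})"
proof (rule equivI)
  have "sym (adjacent A)"
    using A symmetric_mat_index[OF A] by (auto simp: sym_def adjacent_def)
  then show "sym ((adjacent A)\<^sup>* \<inter> {..<dim_row A} \<times> {..<dim_row A})"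
    using sym_rtrancl[of "adjacent A"] by (auto simp: sym_def)
  show "trans ((adjacent A)\<^sup>* \<inter> {..<dim_row A} \<times> {..<dim_row A})"
    by (rule transI) (auto intro: rtrancl_trans)
qed (auto simp: refl_on_def)

section \<open>Component indicators as orthonormal kernel vectors\<close>

locale graph_components =
  fixes n R :: nat and A :: "real mat" and C :: "nat \<Rightarrow> nat set"
  assumes adj: "weighted_adjacency n A" and C: "bij_betw C {..<R} (components A)"
begin

lemma A: "A \<in> carrier_mat n n" "A\<^sup>T = A"
  using adj by (auto simp: weighted_adjacency_def)

lemma C_mem: "r < R \<Longrightarrow> C r \<in> components A"
  using C by (auto simp: bij_betw_def)

lemma
  assumes "r < R"
  shows C_subset: "C r \<subseteq> {..<n}" and card_C_pos: "0 < card (C r)"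
proof -
  note eq = equiv_components[OF A]
  have mem: "C r \<in> {..<dim_row A} // ((adjacent A)\<^sup>* \<inter> {..<dim_row A} \<times> {..<dim_row A})"
    using C_mem[OF assms] by (simp only: Defs.components_def)
  show "C r \<subseteq> {..<n}" using in_quotient_imp_subset[OF eq mem] A by auto
  then show "0 < card (C r)" using in_quotient_imp_non_empty[OF eq mem] by (auto simp: finite_subset card_gt_0_iff)
qed

lemma C_disjoint: "r < R \<Longrightarrow> s < R \<Longrightarrow> i \<in> C r \<Longrightarrow> i \<in> C s \<Longrightarrow> r = s"
  using quotient_disj[OF equiv_components[OF A], of "C r" "C s"] C_mem[of r] C_mem[of s] C
  by (auto simp: Defs.components_def bij_betw_def dest: inj_onD)

lemma C_cover:
  assumes "i < n" shows "\<exists>r<R. i \<in> C r"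
proof -
  have "i \<in> \<Union> (components A)"
    unfolding Defs.components_def Union_quotient[OF equiv_components[OF A]] using A assms by simp
  then show ?thesis using C by (auto simp: bij_betw_def)
qed

lemma C_adjacent:
  assumes "r < R" "(i, j) \<in> adjacent A" "i \<in> C r" shows "j \<in> C r"
proof (rule in_quotient_imp_closed[OF equiv_components[OF A] _ assms(3)])
  show "C r \<in> {..<dim_row A} // ((adjacent A)\<^sup>* \<inter> {..<dim_row A} \<times> {..<dim_row A})"
    using C_mem[OF assms(1)] by (simp add: Defs.components_def)
  show "(i, j) \<in> (adjacent A)\<^sup>* \<inter> {..<dim_row A} \<times> {..<dim_row A}"
    using assms(2) by (auto simp: adjacent_def)
qed

lemma C_adjacent_iff:
  assumes "r < R" "(i, j) \<in> adjacent A" shows "i \<in> C r \<longleftrightarrow> j \<in> C r"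
proof -
  have "(j, i) \<in> adjacent A"
    using assms(2) symmetric_mat_index[OF A] A(1) by (auto simp: adjacent_def)
  then show ?thesis using C_adjacent assms by blast
qed

definition theta_mat :: "real mat" where
  "theta_mat = mat n R (\<lambda>(i, r). component_vec n (C r) $ i)"

lemma theta_mat_carrier: "theta_mat \<in> carrier_mat n R"
  by (simp add: theta_mat_def)

lemma component_vec_carrier: "component_vec n S \<in> carrier_vec n"
  by (simp add: component_vec_def)

lemma col_theta_mat: "r < R \<Longrightarrow> col theta_mat r = component_vec n (C r)"
  by (intro eq_vecI) (auto simp: theta_mat_def component_vec_def)

lemma scalar_prod_component_vec:
  assumes "r < R" "s < R"
  shows "component_vec n (C r) \<bullet> component_vec n (C s) = (if r = s then 1 else 0)"
proof -
  have "component_vec n (C r) \<bullet> component_vec n (C s) =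
      (\<Sum>i<n. if i \<in> C r \<and> r = s then 1 / real (card (C r)) else 0)"
    unfolding scalar_prod_def
    using C_disjoint[OF assms] by (intro sum.cong) (auto simp: component_vec_def)
  also have "\<dots> = (if r = s then \<Sum>i\<in>C r. 1 / real (card (C r)) else 0)"
    using C_subset[OF assms(1)] by (auto simp: Int_absorb1 simp flip: sum.inter_restrict)
  also have "\<dots> = (if r = s then 1 else 0)" using card_C_pos[OF assms(1)] by auto
  finally show ?thesis .
qed

lemma theta_mat_orthonormal: "theta_mat\<^sup>T * theta_mat = 1\<^sub>m R"
  using theta_mat_carrier
  by (intro eq_matI) (auto simp: col_theta_mat scalar_prod_component_vec)

sublocale orthonormal_columns theta_mat n R
  by unfold_locales (rule theta_mat_carrier, rule theta_mat_orthonormal)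

lemma laplacian_theta_mat: "laplacian A * theta_mat = 0\<^sub>m n R"
proof (rule eq_matI)
  fix i r assume "i < dim_row (0\<^sub>m n R)" "r < dim_col (0\<^sub>m n R)"
  then have ir: "i < n" "r < R" by auto
  have "laplacian A *\<^sub>v component_vec n (C r) = 0\<^sub>v n"
  proof (rule laplacian_locally_constant[OF A component_vec_carrier])
    fix i j assume ij: "(i, j) \<in> adjacent A"
    then have "i < n" "j < n" using A(1) by (auto simp: adjacent_def)
    then show "component_vec n (C r) $ i = component_vec n (C r) $ j"
      using C_adjacent_iff[OF ir(2) ij] by (simp add: component_vec_def)
  qed
  moreover have "(laplacian A * theta_mat) $$ (i, r) = (laplacian A *\<^sub>v component_vec n (C r)) $ i"
    using A(1) theta_mat_carrier ir by (simp add: col_theta_mat)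
  ultimately show "(laplacian A * theta_mat) $$ (i, r) = 0\<^sub>m n R $$ (i, r)"
    using ir by (simp del: index_mult_mat_vec)
qed (use A(1) theta_mat_carrier in auto)

text \<open>The mean of \<open>y\<close> over \<open>C r\<close>: one square root normalises the
  indicator in the scalar product, the other is its entry when the projection is read off at a
  node.\<close>

definition block_value :: "real vec \<Rightarrow> nat \<Rightarrow> real" where
  "block_value y r = (component_vec n (C r) \<bullet> y) / sqrt (real (card (C r)))"

lemma proj_index:
  assumes "y \<in> carrier_vec n" "r < R" "i \<in> C r"
  shows "proj y $ i = block_value y r"
proof -
  have i: "i < n" using C_subset assms by auto
  have "proj y $ i = (\<Sum>s<R. theta_mat $$ (i, s) * (theta_mat\<^sup>T *\<^sub>v y) $ s)"
  proof -
    have "(theta_mat *\<^sub>v z) $ i = (\<Sum>s<R. theta_mat $$ (i, s) * z $ s)" if "z \<in> carrier_vec R" for z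
      using that i theta_mat_carrier by (simp add: scalar_prod_def lessThan_atLeast0)
    then show ?thesis unfolding proj_def using transpose_mult_carrier by blast
  qed
  also have "\<dots> = (\<Sum>s<R. component_vec n (C s) $ i * (component_vec n (C s) \<bullet> y))"
  proof (rule sum.cong[OF refl])
    fix s assume s: "s \<in> {..<R}"
    then have "(theta_mat\<^sup>T *\<^sub>v y) $ s = component_vec n (C s) \<bullet> y"
      using theta_mat_carrier by (simp add: col_theta_mat)
    then show "theta_mat $$ (i, s) * (theta_mat\<^sup>T *\<^sub>v y) $ s =
        component_vec n (C s) $ i * (component_vec n (C s) \<bullet> y)"
      using i s by (simp add: theta_mat_def)
  qed
  also have "\<dots> = (\<Sum>s<R. if s = r then block_value y r else 0)"
  proof (rule sum.cong[OF refl])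
    fix s assume "s \<in> {..<R}"
    then have "i \<in> C s \<longleftrightarrow> s = r" using C_disjoint[of s r i] assms(2,3) by auto
    moreover have "component_vec n (C s) $ i = (if i \<in> C s then 1 / sqrt (real (card (C s))) else 0)"
      using i by (simp add: component_vec_def)
    ultimately show "component_vec n (C s) $ i * (component_vec n (C s) \<bullet> y) =
        (if s = r then block_value y r else 0)"
      by (simp add: block_value_def)
  qed
  also have "\<dots> = block_value y r" using assms(2) by simp
  finally show ?thesis .
qed

text \<open>Labels each position of the block vector by its component. Since no \<open>y\<close>
  occurs, one relabelling of the nodes will serve all initial vectors.\<close>

definition block_index :: "nat list" where
  "block_index = concat (map (\<lambda>r. replicate (card (C r)) r) [0..<R])"

lemma block_vec_eq: "block_vec n R C y = vec_of_list (map (block_value y) block_index)"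
  by (simp add: block_vec_def block_index_def block_value_def map_concat o_def)

text \<open>Listing the component of each node in node order and in block order gives lists with the
  same multiset: label \<open>s\<close> occurs \<open>card (C s)\<close> times in both. Hence a
  permutation \<open>p\<close> sends each node to a position in the block of its component.\<close>

lemma exists_block_permutation:
  obtains p where "p permutes {..<n}" "length block_index = n"
    "\<And>i. i < n \<Longrightarrow> block_index ! p i < R \<and> i \<in> C (block_index ! p i)"
proof -
  obtain c where c: "\<And>i. i < n \<Longrightarrow> c i < R \<and> i \<in> C (c i)" using C_cover by metis
  have count: "count (mset (concat (map (\<lambda>r. replicate (k r) r) [0..<m]))) s = (if s < m then k s else 0)"
    for k :: "nat \<Rightarrow> nat" and m s by (induction m) auto
  have "mset (map c [0..<n]) = mset block_index"
  proof (rule multiset_eqI)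
    fix s
    have "count (mset (map c [0..<n])) s = card {i. i < n \<and> c i = s}"
      by (auto simp: count_mset count_list_eq_length_filter length_filter_conv_card
          simp del: mset_map intro!: arg_cong[where f = card])
    also have "\<dots> = (if s < R then card (C s) else 0)"
    proof (cases "s < R")
      case True
      then have "{i. i < n \<and> c i = s} = C s"
        using c C_subset[OF True] C_disjoint[OF True] by blast
      then show ?thesis using True by simp
    next
      case False
      then have "{i. i < n \<and> c i = s} = {}" using c by auto
      then show ?thesis using False by simp
    qed
    finally show "count (mset (map c [0..<n])) s = count (mset block_index) s"
      by (simp only: block_index_def count)
  qed
  moreover from this have len: "length block_index = n" by (metis diff_zero length_map length_upt size_mset)
  ultimately obtain p where p: "p permutes {..<n}" "permute_list p block_index = map c [0..<n]"
    by (metis mset_eq_permutation)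
  have "c i = block_index ! p i" if "i < n" for i
    using arg_cong[OF p(2), of "\<lambda>l. l ! i"] that len p(1) by (simp add: permute_list_nth)
  then show ?thesis using that p(1) len c by metis
qed

lemma exists_block_permutation_matrix:
  obtains Q where "permutation_matrix n Q"
    "\<And>y. y \<in> carrier_vec n \<Longrightarrow> Q *\<^sub>v block_vec n R C y = proj y"
proof -
  obtain p where p: "p permutes {..<n}" and len: "length block_index = n"
    and mem: "\<And>i. i < n \<Longrightarrow> block_index ! p i < R \<and> i \<in> C (block_index ! p i)"
    using exists_block_permutation by blast
  \<comment> \<open>\<open>p\<close> maps nodes to block positions, whereas the column index of a
    permutation matrix is the one being permuted; hence the inverse.\<close>
  define Q where "Q = mat n n (\<lambda>(i, j). if i = inv_into UNIV p j then 1 else 0 :: real)"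
  have "permutation_matrix n Q"
    unfolding permutation_matrix_def Q_def using permutes_inv[OF p] by blast
  moreover have "Q *\<^sub>v block_vec n R C y = proj y" if y: "y \<in> carrier_vec n" for y
  proof (rule eq_vecI)
    fix i assume "i < dim_vec (proj y)"
    then have i: "i < n" by simp
    have pi: "p i < n" using permutes_in_image[OF p] i by simp
    have inv: "i = inv_into UNIV p j \<longleftrightarrow> p i = j" for j
      using permutes_inverses[OF p] by metis
    have "(Q *\<^sub>v block_vec n R C y) $ i =
        (\<Sum>j<n. (if p i = j then 1 else 0) * block_value y (block_index ! j))"
      using i len unfolding block_vec_eq Q_def
      by (simp add: scalar_prod_def lessThan_atLeast0 vec_of_list_index inv del: sum.delta sum.delta')
    also have "\<dots> = (\<Sum>j<n. if p i = j then block_value y (block_index ! j) else 0)"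
      by (intro sum.cong) auto
    also have "\<dots> = block_value y (block_index ! p i)" using pi by simp
    also have "\<dots> = proj y $ i" using proj_index[OF y, of "block_index ! p i" i] mem[OF i] by auto
    finally show "(Q *\<^sub>v block_vec n R C y) $ i = proj y $ i" .
  qed (simp add: Q_def)
  ultimately show ?thesis using that by blast
qed

end

subsection \<open>The correction by the uniform graph\<close>

lemma H_mat_carrier: "H_mat n \<in> carrier_mat n n"
  by (auto simp: H_mat_def)

text \<open>This Laplacian is \<open>1 / (n - 1)\<close> times the orthogonal projection onto the
  vectors of coordinate sum 0. In the expanded square, the terms with the sum \<open>S\<close>
  combine to a nonpositive number.\<close>

lemma norm2_laplacian_H_mat_le:
  assumes n: "2 \<le> n" and x: "x \<in> carrier_vec n"
  shows "norm2 (laplacian (H_mat n) *\<^sub>v x) \<le> norm2 x / (real n - 1)"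
proof -
  define h where "h = 1 / (real n * (real n - 1))"
  define S where "S = (\<Sum>j<n. x $ j)"
  have H: "H_mat n $$ (i, j) = (if i = j then 0 else h)" if "i < n" "j < n" for i j
    using that by (simp add: H_mat_def h_def)
  have symm: "(H_mat n)\<^sup>T = H_mat n"
    using H_mat_carrier[of n] by (intro eq_matI) (auto simp: H)
  have Lx: "(laplacian (H_mat n) *\<^sub>v x) $ i = h * (real n * x $ i - S)" if "i < n" for i
  proof -
    have "(laplacian (H_mat n) *\<^sub>v x) $ i = (\<Sum>j<n. h * (x $ i - x $ j))"
      unfolding laplacian_mult_vec[OF H_mat_carrier symm x that]
      using that by (intro sum.cong) (auto simp: H)
    then show ?thesis by (simp add: S_def sum_subtractf flip: sum_distrib_left)
  qed
  have xx: "x \<bullet> x = (\<Sum>i<n. (x $ i)\<^sup>2)"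
    using x by (simp add: scalar_prod_def lessThan_atLeast0 power2_eq_square)
  have "(norm2 (laplacian (H_mat n) *\<^sub>v x))\<^sup>2 = (\<Sum>i<n. (h * (real n * x $ i - S))\<^sup>2)"
    using H_mat_carrier[of n] unfolding norm2_power2 scalar_prod_def
    by (simp add: Lx power2_eq_square lessThan_atLeast0 del: index_mult_mat_vec)
  also have "\<dots> = (\<Sum>i<n. (h * real n)\<^sup>2 * (x $ i)\<^sup>2 - h\<^sup>2 * (2 * real n * S) * x $ i + h\<^sup>2 * S\<^sup>2)"
    by (intro sum.cong) (auto simp: power2_eq_square algebra_simps)
  also have "\<dots> = (h * real n)\<^sup>2 * (x \<bullet> x) - h\<^sup>2 * (2 * real n * S) * S + real n * (h\<^sup>2 * S\<^sup>2)"
    by (simp add: sum.distrib sum_subtractf xx S_def flip: sum_distrib_left)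
  also have "\<dots> = (h * real n)\<^sup>2 * (x \<bullet> x) - h\<^sup>2 * S\<^sup>2 * real n"
    by (simp add: power2_eq_square algebra_simps)
  also have "\<dots> \<le> (h * real n)\<^sup>2 * (x \<bullet> x)" by simp
  also have "\<dots> = (norm2 x / (real n - 1))\<^sup>2"
    using n by (simp add: h_def power_divide norm2_power2)
  finally show ?thesis
    by (rule power2_le_imp_le) (use n in simp)
qed

subsection \<open>The embedding dynamics\<close>

text \<open>The factor in \<open>flow_limit\<close>, with \<open>a\<close> for
  \<open>t * lam\<close> and \<open>\<delta>\<close> for \<open>t * d\<close>; the square root alone
  is the factor in \<open>flow_near_proj\<close>.\<close>

definition flow_error :: "real \<Rightarrow> real \<Rightarrow> real" where
  "flow_error a \<delta> = sqrt (exp (- 2 * a) + 2 * \<delta> * (exp \<delta>)\<^sup>2) + \<delta> * exp \<delta>"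

lemma flow_error_tendsto_0:
  assumes a: "filterlim a at_top F" and \<delta>: "(\<delta> \<longlongrightarrow> 0) F"
  shows "((\<lambda>x. flow_error (a x) (\<delta> x)) \<longlongrightarrow> 0) F"
proof -
  have "filterlim (\<lambda>x. - 2 * a x) at_bot F"
    using a by (intro filterlim_tendsto_neg_mult_at_bot[OF tendsto_const]) auto
  then have "((\<lambda>x. exp (- 2 * a x)) \<longlongrightarrow> 0) F"
    by (rule filterlim_compose[OF exp_at_bot])
  then have "((\<lambda>x. flow_error (a x) (\<delta> x)) \<longlongrightarrow> sqrt (0 + 2 * 0 * (exp 0)\<^sup>2) + 0 * exp 0) F"
    unfolding flow_error_def by (intro tendsto_intros \<delta>)
  then show ?thesis by simp
qed

lemma spectral_norm_nonneg:
  assumes "A \<in> carrier_mat n n" "0 < n"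
  shows "0 \<le> spectral_norm A"
proof -
  have "norm2 (unit_vec n 0) = 1" using assms(2) by (simp add: norm2_def)
  then show ?thesis
    using norm2_mult_mat_vec_le[OF assms(1), of "unit_vec n 0"] norm2_nonneg[of "A *\<^sub>v unit_vec n 0"]
    by (simp del: norm2_nonneg)
qed

lemma smult_mat_mult_vec:
  fixes A :: "real mat"
  assumes "x \<in> carrier_vec (dim_col A)"
  shows "(c \<cdot>\<^sub>m A) *\<^sub>v x = c \<cdot>\<^sub>v (A *\<^sub>v x)"
  using assms by (intro eq_vecI) (auto simp: scalar_prod_def sum_distrib_left mult.assoc)

context graph_components
begin

lemma eigval_laplacian_nonneg: "R < n \<Longrightarrow> 0 \<le> eigval (laplacian A) (R + 1)"
  by (rule eigval_gap(1)[OF laplacian_carrier[OF A(1)] laplacian_symmetric[OF A]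
        laplacian_psd[OF adj] theta_mat_carrier theta_mat_orthonormal laplacian_theta_mat])

text \<open>The ideal generator is \<open>\<alpha>\<close> times the Laplacian of \<open>A\<close>.
  By linearity the actual one differs from it by \<open>- \<alpha>\<close> times the Laplacian of
  \<open>A - P\<close>, minus that of \<open>H_mat n\<close>, and the two summands of
  \<open>d\<close> bound these two parts.\<close>

lemma laplacian_flow:
  fixes P :: "real mat"
  assumes n: "2 \<le> n" and R: "R < n" and P: "P \<in> carrier_mat n n"
    and \<alpha>: "0 < \<alpha>" and t: "0 < t" and y: "y \<in> carrier_vec n"
  defines "Z \<equiv> mat_exp (- t \<cdot>\<^sub>m laplacian (\<alpha> \<cdot>\<^sub>m P - H_mat n)) *\<^sub>v y"
    and "err \<equiv> flow_error (t * \<alpha> * eigval (laplacian A) (R + 1))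
      (t * \<alpha> * spectral_norm (laplacian (A - P)) + t / (real n - 1))"
  shows "norm2 (Z - proj Z) \<le> err * norm2 y" "norm2 (Z - proj y) \<le> err * norm2 y"
proof -
  define L where "L = laplacian (\<alpha> \<cdot>\<^sub>m P - H_mat n)"
  define B where "B = \<alpha> \<cdot>\<^sub>m laplacian A"
  define lam where "lam = \<alpha> * eigval (laplacian A) (R + 1)"
  define d where "d = \<alpha> * spectral_norm (laplacian (A - P)) + 1 / (real n - 1)"
  define u where "u s = mat_exp (- s \<cdot>\<^sub>m L) *\<^sub>v y" for s
  note LA = laplacian_carrier[OF A(1)] and LP = laplacian_carrier[OF P]
    and LH = laplacian_carrier[OF H_mat_carrier[of n]]
  have AP: "laplacian (A - P) \<in> carrier_mat n n" by (intro laplacian_carrier) (use A P in auto)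
  have L_eq: "L = \<alpha> \<cdot>\<^sub>m laplacian P - laplacian (H_mat n)"
    unfolding L_def using P H_mat_carrier[of n]
    by (subst laplacian_minus[of _ n]) (auto simp: laplacian_smult)
  have L: "L \<in> carrier_mat n n" unfolding L_eq by (rule minus_carrier_mat[OF LH])
  have pert: "norm2 (L *\<^sub>v x - B *\<^sub>v x) \<le> d * norm2 x" if x: "x \<in> carrier_vec n" for x
  proof -
    have "L *\<^sub>v x - B *\<^sub>v x = (- \<alpha>) \<cdot>\<^sub>v (laplacian (A - P) *\<^sub>v x) - laplacian (H_mat n) *\<^sub>v x"
    proof -
      have "L *\<^sub>v x = \<alpha> \<cdot>\<^sub>v (laplacian P *\<^sub>v x) - laplacian (H_mat n) *\<^sub>v x"
        using x P LP LH by (simp add: L_eq minus_mult_distrib_mat_vec[of _ n n] smult_mat_mult_vec)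
      moreover have "B *\<^sub>v x = \<alpha> \<cdot>\<^sub>v (laplacian A *\<^sub>v x)"
        using x A(1) by (simp add: B_def smult_mat_mult_vec)
      moreover have "laplacian (A - P) *\<^sub>v x = laplacian A *\<^sub>v x - laplacian P *\<^sub>v x"
        using x LA LP by (simp add: laplacian_minus[OF A(1) P] minus_mult_distrib_mat_vec[of _ n n])
      moreover have "\<alpha> \<cdot>\<^sub>v q - h - \<alpha> \<cdot>\<^sub>v a = (- \<alpha>) \<cdot>\<^sub>v (a - q) - h"
        if "a \<in> carrier_vec n" "q \<in> carrier_vec n" "h \<in> carrier_vec n" for a q h
        using that by (intro eq_vecI) (auto simp: algebra_simps)
      ultimately show ?thesis
        using mult_mat_vec_carrier[OF LA x] mult_mat_vec_carrier[OF LP x]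
          mult_mat_vec_carrier[OF LH x] by presburger
    qed
    moreover have "norm2 \<dots> \<le> norm2 ((- \<alpha>) \<cdot>\<^sub>v (laplacian (A - P) *\<^sub>v x)) + norm2 (laplacian (H_mat n) *\<^sub>v x)"
      using x AP LH by (intro norm2_diff_le[of _ n]) auto
    moreover have "norm2 ((- \<alpha>) \<cdot>\<^sub>v (laplacian (A - P) *\<^sub>v x))
        \<le> \<alpha> * (spectral_norm (laplacian (A - P)) * norm2 x)"
      unfolding norm2_smult using norm2_mult_mat_vec_le[OF AP x] \<alpha> by simp
    ultimately show ?thesis
      using norm2_laplacian_H_mat_le[OF n x] by (simp add: d_def algebra_simps)
  qed
  interpret perturbed_flow theta_mat n R L B lam d t u
  proof
    show "L \<in> carrier_mat n n" by (rule L)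
    show "B \<in> carrier_mat n n" using LA by (simp add: B_def)
    have "(\<alpha> \<cdot>\<^sub>m M)\<^sup>T = \<alpha> \<cdot>\<^sub>m M\<^sup>T" for M :: "real mat" by (intro eq_matI) auto
    then show "B\<^sup>T = B" using laplacian_symmetric[OF A] by (simp add: B_def)
    show "B * theta_mat = 0\<^sub>m n R"
      using mult_smult_assoc_mat[OF LA theta_mat_carrier] by (simp add: B_def laplacian_theta_mat)
    show "0 \<le> lam" using eigval_laplacian_nonneg[OF R] \<alpha> by (simp add: lam_def)
    show "lam * (w \<bullet> w) \<le> w \<bullet> (B *\<^sub>v w)" if "w \<in> carrier_vec n" "theta_mat\<^sup>T *\<^sub>v w = 0\<^sub>v R" for w
    proof -
      have "eigval (laplacian A) (R + 1) * (w \<bullet> w) \<le> w \<bullet> (laplacian A *\<^sub>v w)"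
        by (rule eigval_gap(2)[OF LA laplacian_symmetric[OF A] laplacian_psd[OF adj]
              theta_mat_carrier theta_mat_orthonormal laplacian_theta_mat R that])
      then have "\<alpha> * (eigval (laplacian A) (R + 1) * (w \<bullet> w)) \<le> \<alpha> * (w \<bullet> (laplacian A *\<^sub>v w))"
        using \<alpha> by simp
      then show ?thesis
        using that A(1) by (simp add: B_def lam_def smult_mat_mult_vec mult.assoc)
    qed
    show "norm2 (L *\<^sub>v x - B *\<^sub>v x) \<le> d * norm2 x" if "x \<in> carrier_vec n" for x
      by (rule pert[OF that])
    show "0 \<le> d" using spectral_norm_nonneg[OF AP] \<alpha> n by (simp add: d_def)
    show "0 \<le> t" using t by simp
    show "u s \<in> carrier_vec n" for s
      unfolding u_def by (rule carrier_vecI) (use L in \<open>simp add: mat_exp_def\<close>)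
    show "((\<lambda>s. u s $ i) has_real_derivative - (L *\<^sub>v u s) $ i) (at s)" if "i < n" for s i
      unfolding u_def by (rule mat_exp_solves_ivp(2)[OF L y that])
  qed
  have u0: "u 0 = y" unfolding u_def by (rule mat_exp_solves_ivp(1)[OF L y])
  have ut: "u t = Z" by (simp add: u_def Z_def L_def)
  have td: "t * d = t * \<alpha> * spectral_norm (laplacian (A - P)) + t / (real n - 1)"
    by (simp add: d_def distrib_left mult.assoc)
  have tlam: "t * lam = t * \<alpha> * eigval (laplacian A) (R + 1)" by (simp add: lam_def)
  show "norm2 (Z - proj y) \<le> err * norm2 y"
    using flow_limit unfolding u0 ut td tlam err_def flow_error_def .
  have "norm2 (Z - proj Z) \<le> sqrt (exp (- 2 * (t * lam)) + 2 * (t * d) * (exp (t * d))\<^sup>2) * norm2 y"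
    using flow_near_proj unfolding u0 ut .
  \<comment> \<open>The nonnegative drift term is added so that both claims share one error.\<close>
  also have "\<dots> \<le> err * norm2 y"
    unfolding err_def flow_error_def td[symmetric] tlam[symmetric]
    using t d by (intro mult_right_mono) auto
  finally show "norm2 (Z - proj Z) \<le> err * norm2 y" .
qed

text \<open>The vector \<open>proj x\<close> lies in the kernel, hence in the range of
  \<open>U\<close>, where the projection by \<open>U\<close> is the nearest point to
  \<open>x\<close>.\<close>

lemma norm2_diff_kernel_projection_le:
  assumes U: "U \<in> carrier_mat n R" "U\<^sup>T * U = 1\<^sub>m R"
    and kernel: "vec_space.col_space n U = mat_kernel (laplacian A)" and x: "x \<in> carrier_vec n"
  shows "norm2 (x - U *\<^sub>v (U\<^sup>T *\<^sub>v x)) \<le> norm2 (x - proj x)"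
proof -
  interpret U: orthonormal_columns U n R using U by unfold_locales
  note LA = laplacian_carrier[OF A(1)]
  have "laplacian A *\<^sub>v proj x = (laplacian A * theta_mat) *\<^sub>v (theta_mat\<^sup>T *\<^sub>v x)"
    unfolding proj_def using LA theta_mat_carrier by (intro assoc_mult_mat_vec[symmetric]) auto
  also have "\<dots> = 0\<^sub>v n"
  proof -
    have "0\<^sub>m n R *\<^sub>v z = 0\<^sub>v n" if "z \<in> carrier_vec R" for z :: "real vec"
      using that by auto
    then show ?thesis by (simp add: laplacian_theta_mat)
  qed
  finally have "proj x \<in> vec_space.col_space n U"
    unfolding kernel using LA by (intro mat_kernelI[of _ n n]) auto
  then obtain q where "q \<in> carrier_vec R" "U *\<^sub>v q = proj x"
    unfolding vec_space.col_space_eq[OF U(1)] using U(1) by auto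
  then show ?thesis using U.norm2_diff_proj_le_diff[OF x] by (metis U.proj_def)
qed

end

section \<open>Passage to the limit\<close>

theorem theorem10:
  fixes p :: "nat \<Rightarrow> nat"
    and X :: "nat \<Rightarrow> nat \<Rightarrow> real vec"
    and \<tau> :: "nat \<Rightarrow> nat \<Rightarrow> real"
    and P Pstar U\<^sub>0 :: "nat \<Rightarrow> real mat"
    and \<alpha> t :: "nat \<Rightarrow> real"
    and y :: "nat \<Rightarrow> nat \<Rightarrow> real vec"
    and Y :: "nat \<Rightarrow> nat \<Rightarrow> real \<Rightarrow> real vec"
    and R :: "nat \<Rightarrow> nat"
    and C :: "nat \<Rightarrow> nat \<Rightarrow> nat set"
  assumes X: "\<And>n i. n \<ge> 2 \<Longrightarrow> i < n \<Longrightarrow> X n i \<in> carrier_vec (p n)"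
    and \<tau>: "\<And>n i. n \<ge> 2 \<Longrightarrow> i < n \<Longrightarrow> \<tau> n i > 0"
    and P: "\<And>n. n \<ge> 2 \<Longrightarrow> P n = tsne_P n (X n) (\<tau> n)"
    and \<alpha>: "\<And>n. n \<ge> 2 \<Longrightarrow> \<alpha> n > 0"
    and t: "\<And>n. n \<ge> 2 \<Longrightarrow> t n > 0"
    and y: "\<And>l n. l \<in> {1, 2} \<Longrightarrow> n \<ge> 2 \<Longrightarrow> y l n \<in> carrier_vec n"
    and Y: "\<And>l n s. l \<in> {1, 2} \<Longrightarrow> n \<ge> 2 \<Longrightarrow>
              Y l n s = mat_exp (- s \<cdot>\<^sub>m laplacian (\<alpha> n \<cdot>\<^sub>m P n - H_mat n)) *\<^sub>v y l n"
    and i_pos: "\<forall>\<^sub>F n in sequentially. (MIN l\<in>{1, 2}. norm2 (y l n)) > 0"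
    and i_bdd: "(\<lambda>n. MAX l\<in>{1, 2}. norm_sup (y l n)) \<in> O(\<lambda>_. 1)"
    and ii_wc: "\<forall>\<^sub>F n in sequentially. well_conditioned n (Pstar n) \<and>
                  card (components (Pstar n)) = R n \<and> R n + 1 \<le> n"
    and ii_gap: "(\<lambda>n. max (inverse (t n * \<alpha> n)) (spectral_norm (laplacian (Pstar n - P n))))
                   \<in> o(\<lambda>n. eigval (laplacian (Pstar n)) (R n + 1))"
    and ii_approx: "(\<lambda>n. t n * \<alpha> n * spectral_norm (laplacian (Pstar n - P n))) \<in> o(\<lambda>_. 1)"
    and iii_\<alpha>: "(\<lambda>n. inverse (real n * eigval (laplacian (P n)) (R n + 1))) \<in> o(\<alpha>)"
    and iii_t: "t \<in> o(real)"
    and U\<^sub>0: "\<forall>\<^sub>F n in sequentially. U\<^sub>0 n \<in> carrier_mat n (R n) \<and>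
               (U\<^sub>0 n)\<^sup>T * U\<^sub>0 n = 1\<^sub>m (R n) \<and>
               vec_space.col_space n (U\<^sub>0 n) = mat_kernel (laplacian (Pstar n))"
    and C: "\<forall>\<^sub>F n in sequentially. bij_betw (C n) {..<R n} (components (Pstar n))"
  shows "(\<forall>l\<in>{1, 2}. (\<lambda>n. norm2 (Y l n (t n) - U\<^sub>0 n *\<^sub>v ((U\<^sub>0 n)\<^sup>T *\<^sub>v Y l n (t n)))
                            / norm2 (Y l n 0)) \<longlonglongrightarrow> 0) \<and>
         (\<exists>Q. (\<forall>n. permutation_matrix n (Q n)) \<and>
              (\<forall>l\<in>{1, 2}. (\<lambda>n. norm2 (Y l n (t n) - Q n *\<^sub>v block_vec n (R n) (C n) (y l n))
                                 / norm2 (Y l n 0)) \<longlonglongrightarrow> 0))"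
proof -
  define a where "a n = t n * \<alpha> n * eigval (laplacian (Pstar n)) (R n + 1)" for n
  define sn where "sn n = spectral_norm (laplacian (Pstar n - P n))" for n
  define \<delta> where "\<delta> n = t n * \<alpha> n * sn n + t n / (real n - 1)" for n
  define err where "err n = flow_error (a n) (\<delta> n)" for n
  define good where "good n \<longleftrightarrow> 2 \<le> n \<and> R n < n \<and> graph_components n (R n) (Pstar n) (C n)" for n
  have good: "\<forall>\<^sub>F n in sequentially. good n"
    using ii_wc C eventually_ge_at_top[of 2]
    by eventually_elim (auto simp: good_def graph_components_def well_conditioned_def)
  have Pn: "P n \<in> carrier_mat n n" if "2 \<le> n" for n
    using P[OF that] by (simp add: tsne_P_def)
  have a_lim: "filterlim a at_top sequentially"
    unfolding filterlim_at_top
  proof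
    fix z :: real
    \<comment> \<open>With this constant the gap hypothesis bounds
      \<open>inverse (t n * \<alpha> n)\<close> by the eigenvalue divided by \<open>max z 1\<close>,
      that is, \<open>max z 1 \<le> a n\<close>. The maximum keeps \<open>c\<close> positive for
      every \<open>z\<close>.\<close>
    define c where "c = 1 / max z 1"
    have c: "c > 0" by (simp add: c_def)
    have "\<forall>\<^sub>F n in sequentially. norm (max (inverse (t n * \<alpha> n)) (sn n))
        \<le> c * norm (eigval (laplacian (Pstar n)) (R n + 1))"
      using landau_o.smallD[OF ii_gap c] by (simp add: sn_def)
    then show "\<forall>\<^sub>F n in sequentially. z \<le> a n"
      using good
    proof eventually_elim
      case (elim n)
      let ?lam = "eigval (laplacian (Pstar n)) (R n + 1)"
      have n: "2 \<le> n" and "0 \<le> ?lam"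
        using elim(2) graph_components.eigval_laplacian_nonneg[of n "R n" "Pstar n" "C n"]
        by (auto simp: good_def)
      then have "inverse (t n * \<alpha> n) \<le> c * ?lam" using elim(1) by simp
      moreover have pos: "0 < t n * \<alpha> n" using t[OF n] \<alpha>[OF n] by simp
      ultimately have "1 \<le> c * a n" by (simp add: a_def field_simps)
      then have "max z 1 \<le> a n" by (simp add: c_def field_simps)
      then show ?case by simp
    qed
  qed
  have "(\<lambda>n. t n * \<alpha> n * sn n) \<longlonglongrightarrow> 0"
    using smalloD_tendsto[OF ii_approx] by (simp add: sn_def)
  moreover have "(\<lambda>n. t n / (real n - 1)) \<longlonglongrightarrow> 0"
  \<comment> \<open>The factor 2 is from \<open>n \<le> 2 * (n - 1)\<close> for
    \<open>n \<ge> 2\<close>.\<close>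
  proof (rule tendsto_sandwich[of "\<lambda>_. 0" _ _ "\<lambda>n. 2 * (t n / real n)"])
    show "\<forall>\<^sub>F n in sequentially. 0 \<le> t n / (real n - 1)"
      using eventually_ge_at_top[of 2]
      by eventually_elim (auto intro!: divide_nonneg_nonneg less_imp_le[OF t])
    show "\<forall>\<^sub>F n in sequentially. t n / (real n - 1) \<le> 2 * (t n / real n)"
      using eventually_ge_at_top[of 2]
    proof eventually_elim
      case (elim n)
      then show ?case using t[OF elim] by (simp add: field_simps)
    qed
    show "(\<lambda>n. 2 * (t n / real n)) \<longlonglongrightarrow> 0"
      using tendsto_mult_right_zero[OF smalloD_tendsto[OF iii_t], of 2] by simp
  qed simp
  ultimately have "\<delta> \<longlonglongrightarrow> 0" unfolding \<delta>_def using tendsto_add_zero by blast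
  \<comment> \<open>The absolute value gives an upper bound for the quotients that is visibly
    nonnegative.\<close>
  then have err_lim: "(\<lambda>n. \<bar>err n\<bar>) \<longlonglongrightarrow> 0"
    unfolding err_def by (intro tendsto_rabs_zero flow_error_tendsto_0 a_lim)
  have ratio_lim: "(\<lambda>n. norm2 (v n) / norm2 (Y l n 0)) \<longlonglongrightarrow> 0"
    if l: "l \<in> {1, 2}" and v: "\<forall>\<^sub>F n in sequentially. norm2 (v n) \<le> err n * norm2 (y l n)" for v l
  proof (rule tendsto_sandwich[OF _ _ tendsto_const err_lim])
    show "\<forall>\<^sub>F n in sequentially. 0 \<le> norm2 (v n) / norm2 (Y l n 0)" by simp
    show "\<forall>\<^sub>F n in sequentially. norm2 (v n) / norm2 (Y l n 0) \<le> \<bar>err n\<bar>"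
      using v eventually_ge_at_top[of 2]
    proof eventually_elim
      case (elim n)
      have "\<alpha> n \<cdot>\<^sub>m P n - H_mat n \<in> carrier_mat n n" using Pn H_mat_carrier[of n] elim(2) by auto
      then have "Y l n 0 = y l n"
        using mat_exp_solves_ivp(1)[OF laplacian_carrier y[OF l elim(2)]] Y[OF l elim(2)] by simp
      moreover have "norm2 (v n) / norm2 (y l n) \<le> \<bar>err n\<bar>"
      \<comment> \<open>A quotient with denominator 0 has the value 0.\<close>
      proof (cases "norm2 (y l n) = 0")
        case False
        then have pos: "0 < norm2 (y l n)" using norm2_nonneg[of "y l n"] by linarith
        then have "norm2 (v n) / norm2 (y l n) \<le> err n" using elim(1) by (simp add: divide_le_eq)
        then show ?thesis by linarith
      qed simp
      ultimately show ?case by simp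
    qed
  qed
  have flow: "norm2 (Y l n (t n) - orthonormal_columns.proj (graph_components.theta_mat n (R n) (C n)) (Y l n (t n)))
        \<le> err n * norm2 (y l n)"
      "norm2 (Y l n (t n) - orthonormal_columns.proj (graph_components.theta_mat n (R n) (C n)) (y l n))
        \<le> err n * norm2 (y l n)"
    if "good n" "l \<in> {1, 2}" for n l
  proof -
    interpret graph_components n "R n" "Pstar n" "C n" using that(1) by (simp add: good_def)
    have n: "2 \<le> n" "R n < n" using that(1) by (auto simp: good_def)
    show "norm2 (Y l n (t n) - proj (Y l n (t n))) \<le> err n * norm2 (y l n)"
      "norm2 (Y l n (t n) - proj (y l n)) \<le> err n * norm2 (y l n)"
      unfolding Y[OF that(2) n(1)] err_def a_def \<delta>_def sn_def
      by (rule laplacian_flow[OF n Pn[OF n(1)] \<alpha>[OF n(1)] t[OF n(1)] y[OF that(2) n(1)]])+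
  qed
  have "(\<lambda>n. norm2 (Y l n (t n) - U\<^sub>0 n *\<^sub>v ((U\<^sub>0 n)\<^sup>T *\<^sub>v Y l n (t n))) / norm2 (Y l n 0)) \<longlonglongrightarrow> 0"
    if l: "l \<in> {1, 2}" for l
  proof (rule ratio_lim[OF l])
    show "\<forall>\<^sub>F n in sequentially.
        norm2 (Y l n (t n) - U\<^sub>0 n *\<^sub>v ((U\<^sub>0 n)\<^sup>T *\<^sub>v Y l n (t n))) \<le> err n * norm2 (y l n)"
      using good U\<^sub>0
    proof eventually_elim
      case (elim n)
      interpret graph_components n "R n" "Pstar n" "C n" using elim(1) by (simp add: good_def)
      have n: "2 \<le> n" using elim(1) by (simp add: good_def)
      have "Y l n (t n) \<in> carrier_vec n"
        unfolding Y[OF l n] by (rule carrier_vecI) (simp add: mat_exp_def H_mat_def)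
      then show ?case
        using norm2_diff_kernel_projection_le[of "U\<^sub>0 n" "Y l n (t n)"] flow(1)[OF elim(1) l] elim(2)
        by linarith
    qed
  qed
  \<comment> \<open>\<open>Q\<close> must be a permutation matrix for every \<open>n\<close>, but
    the components are enumerated only for \<open>good n\<close>; elsewhere the identity is taken.
    Quantifying over \<open>z\<close> inside makes the same matrix serve both values of
    \<open>l\<close>.\<close>
  moreover have "\<exists>Q. permutation_matrix n Q \<and> (good n \<longrightarrow> (\<forall>z \<in> carrier_vec n.
      Q *\<^sub>v block_vec n (R n) (C n) z =
        orthonormal_columns.proj (graph_components.theta_mat n (R n) (C n)) z))" for n
  proof (cases "good n")
    case True
    then interpret graph_components n "R n" "Pstar n" "C n" by (simp add: good_def)
    show ?thesis using exists_block_permutation_matrix by metis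
  next
    case False
    have "permutation_matrix n (mat n n (\<lambda>(i, j). if i = id j then 1 else 0))"
      unfolding permutation_matrix_def using permutes_id by blast
    then show ?thesis using False by blast
  qed
  then obtain Q where Q: "\<And>n. permutation_matrix n (Q n)"
    and Q_block: "\<And>n z. good n \<Longrightarrow> z \<in> carrier_vec n \<Longrightarrow> Q n *\<^sub>v block_vec n (R n) (C n) z =
        orthonormal_columns.proj (graph_components.theta_mat n (R n) (C n)) z"
    by metis
  have "(\<lambda>n. norm2 (Y l n (t n) - Q n *\<^sub>v block_vec n (R n) (C n) (y l n)) / norm2 (Y l n 0)) \<longlonglongrightarrow> 0"
    if l: "l \<in> {1, 2}" for l
  proof (rule ratio_lim[OF l])
    show "\<forall>\<^sub>F n in sequentially.
        norm2 (Y l n (t n) - Q n *\<^sub>v block_vec n (R n) (C n) (y l n)) \<le> err n * norm2 (y l n)"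
      using good
    proof eventually_elim
      case (elim n)
      then have "y l n \<in> carrier_vec n" using y[OF l] by (simp add: good_def)
      then show ?case using flow(2)[OF elim l] Q_block[OF elim] by simp
    qed
  qed
  ultimately show ?thesis using Q by blast
qed

end
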